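(* Let $(B(t,y),Q(t,y))$ be a (Whitt) two-parameter fluid model tracking elapsed times with input data $(\lambda(\cdot),\tilde q(0,x),b(0,x))$ and $q(0,x)=\tilde q(0,x)$. For each $t\ge0$, let $\eta_t[0,y]:=\tilde Q(t,y)$ and $\nu_t[0,y]:=B(t,y)$ for each $y\ge0$, and define $X(t):=B(t,\infty)+Q(t,\infty)$. Then $(\eta,\nu,X)$ is a (Kang-Ramanan) measure-valued fluid model tracking elapsed times with input data $(\lambda(\cdot),\eta_0,\nu_0,X(0))$ such that $(\eta_0,\nu_0,X(0))\in\mathcal S_0$.
   Context: **Primitives.** $\lambda(\cdot)\ge 0$ is the arrival rate function on $[0,\infty)$ and $E(t)=\int_0^t\lambda(s)\,ds$. $G^s$ and $G^r$ are the service and patience time distribution functions, with $G^s(0+)=G^r(0+)=0$; $\bar G^s=1-G^s$, $\bar G^r=1-G^r$; $H^r=\inf\{x\in\mathbb R_+:G^r(x)=1\}$, $H^s=\inf\{x\in\mathbb R_+:G^s(x)=1\}$. It is assumed that $G^s,G^r$ have densities $g^s,g^r$ on $[0,\infty)$; the hazard rates are $h^r=g^r/\bar G^r$ on $[0,H^r)$ and $h^s=g^s/\bar G^s$ on $[0,H^s)$. $\mathcal C_b(\mathbb R_+)$ is the set of bounded continuous real functions on $\mathbb R_+=[0,\infty)$; $a\wedge b=\min(a,b)$, $a^+=[a]^+=\max(a,0)$. **The set $\mathcal S_0$** consists of triples $(\eta,\nu,x)$ with $\eta$ a nonnegative finite measure on $[0,\infty)$ with support in $[0,H^r)$, $\nu$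 a nonnegative finite measure on $[0,\infty)$ with support in $[0,H^s)$, $x\in\mathbb R_+$, $1-\nu[0,H^s)=[1-x]^+$ and $\nu[0,H^s)+\eta[0,H^r)=x$. **Whitt's two-parameter fluid model.** Consider functions with Lebesgue integrable densities in the second variable: $B(t,y)=\int_0^y b(t,x)dx\le 1$, $\tilde Q(t,y)=\int_0^y\tilde q(t,x)dx\ge 0$, $Q(t,y)=\int_0^y q(t,x)dx\ge 0$, where $\tilde q(0,\cdot)=q(0,\cdot)$ has support in $[0,H^r)$ and $b(0,\cdot)$ has support in $[0,H^s)$. The pair $(B(t,y),Q(t,y))$ is a two-parameter fluid model tracking elapsed times with input data $(\lambda(\cdot),\tilde q(0,x),b(0,x))$ if: (i) $b(t+u,x+u)=b(t,x)\frac{\bar G^s(x+u)}{\bar G^s(x)}$ for $x\in[0,H^s)$, $t\ge0$, $u>0$. (ii) $\tilde q(t+u,x+u)=\tilde q(t,x)\frac{\bar G^r(x+u)}{\bar G^r(x)}$ for $x\in[0,H^r)$, $t\ge0$, $u>0$. (iii) There is a queue boundary function $w(t)$ such that $\tilde Q(t,w(t))=Q(t,\infty)$, and $q(t,x)=\tilde q(t,x)$ for $x\le w(t)$, $q(t,x)=0$ for $x>w(t)$. (iv) With $\sigma(t)=\int_{[0,H^s)}b(t,x)h^s(x)dx$: $b(t,0)=\lambda(t)$ if $B(t,\infty)<1$; $b(t,0)=\sigma(t)\wedge\lambda(t)$ if $B(t,\infty)=1$ and $Q(t,\infty)=0$; $b(t,0)=\sigma(t)$ if $B(t,\infty)=1$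 and $Q(t,\infty)>0$. Also $\tilde q(t,0)=\lambda(t)$. And $q(t,0)=\lambda(t)$ if $Q(t,\infty)>0$ ($w(t)>0$); $q(t,0)=\lambda(t)-(\sigma(t)\wedge\lambda(t))$ if $B(t,\infty)=1$ and $Q(t,\infty)=0$; $q(t,0)=0$ if $B(t,\infty)<1$. (v) With $\alpha(t)=\int_{[0,H^r)}q(t,x)h^r(x)dx$, for $t\ge 0$: $\int_0^t\lambda(s)ds+\int_0^\infty q(0,x)dx=\int_0^\infty q(t,x)dx+\int_0^t b(s,0)ds+\int_0^t\alpha(s)ds$. **Kang-Ramanan's measure-valued fluid model.** For each $t$, $\eta_t$ and $\nu_t$ are nonnegative finite measures on $[0,\infty)$ with supports in $[0,H^r)$ and $[0,H^s)$ respectively. The triple $(\eta,\nu,X)$ is a measure-valued fluid model tracking elapsed times with input data $(\lambda(\cdot),\eta_0,\nu_0,X(0))$, $(\eta_0,\nu_0,X(0))\in\mathcal S_0$, if for every $\psi\in\mathcal C_b(\mathbb R_+)$ and $t\ge0$: $$\int_0^\infty\psi(x)\eta_t(dx)=\int_{[0,H^r)}\psi(x+t)\tfrac{\bar G^r(x+t)}{\bar G^r(x)}\eta_0(dx)+\int_0^t\psi(t-s)\bar G^r(t-s)\lambda(s)ds,$$ $$\int_0^\infty\psi(x)\nu_t(dx)=\int_{[0,H^s)}\psi(x+t)\tfrac{\bar G^s(x+t)}{\bar G^s(x)}\nu_0(dx)+\int_{[0,t]}\psi(t-s)\bar G^s(t-s)dK(s),$$ where $K(t)=B(t)+D(t)-B(0)=\nu_t[0,H^s)+D(t)-\nu_0[0,H^s)$;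 $D(t)=\int_0^t\big(\int_{[0,H^s)}h^s(x)\nu_s(dx)\big)ds$; $E(t)+Q(0)=Q(t)+K(t)+R(t)$; $R(t)=\int_0^t\big(\int_{[0,\chi(s)]}h^r(x)\eta_s(dx)\big)ds$; $\chi(s)=\inf\{x\in[0,H^r):\eta_s[0,x]\ge Q(s)\}$; $Q(t)=(X(t)-1)^+$; $B(t)=\nu_t[0,\infty)=X(t)\wedge1=1-(1-X(t))^+$; and $Q(t)(1-B(t))=0$.
   Formalization: Adds: Q(t,∞)>0 implies B(t,∞)=1; b(t,·) and q̃(t,·) vanish off [0,H^s), [0,H^r) at all t≥0, not only t=0; densities are nonnegative. Without the first two the claim fails (e.g. λ=0, b=0, q=q̃≠0). (iii) and q(0,x)=q̃(0,x) are required only for x>0. *)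

theory Defs
  imports "HOL-Probability.Probability"
begin

definition dist_with_density :: "(real \<Rightarrow> real) \<Rightarrow> (real \<Rightarrow> real) \<Rightarrow> bool" where
  "dist_with_density G g \<longleftrightarrow>
     (\<exists>M. real_distribution M \<and> G = cdf M) \<and>
     (G \<longlongrightarrow> 0) (at_right 0) \<and>
     (\<forall>x\<ge>0. 0 \<le> g x) \<and>
     set_integrable lborel {0..} g \<and>
     (\<forall>x\<ge>0. G x = (LINT y:{0..x}|lborel. g y))"

definition arrival_rate :: "(real \<Rightarrow> real) \<Rightarrow> bool" where
  "arrival_rate lam \<longleftrightarrow>
     (\<forall>t\<ge>0. 0 \<le> lam t \<and> set_integrable lebesgue {0..t} lam)"

definition arrivals :: "(real \<Rightarrow> real) \<Rightarrow> real \<Rightarrow> real" where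
  "arrivals lam t = (LINT s:{0..t}|lebesgue. lam s)"

definition right_end :: "(real \<Rightarrow> real) \<Rightarrow> ereal" where
  "right_end G = Inf (ereal ` {x. 0 \<le> x \<and> G x = 1})"

definition age_range :: "(real \<Rightarrow> real) \<Rightarrow> real set" where
  "age_range G = {x. 0 \<le> x \<and> ereal x < right_end G}"

text \<open>The hazard rate is only ever evaluated on \<^term>\<open>age_range G\<close>, where \<^term>\<open>G x < 1\<close>.\<close>

definition hazard :: "(real \<Rightarrow> real) \<Rightarrow> (real \<Rightarrow> real) \<Rightarrow> real \<Rightarrow> real" where
  "hazard G g x = g x / (1 - G x)"

text \<open>
  Finite measures on the half-line are Borel measures on the whole line. Having support in
  \<open>[0,H)\<close> means being concentrated there; the closed topological support is not meant, since it
  may contain \<open>H\<close>.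
\<close>

definition finite_measure_on :: "(real \<Rightarrow> real) \<Rightarrow> real measure \<Rightarrow> bool" where
  "finite_measure_on G M \<longleftrightarrow>
     sets M = sets borel \<and> finite_measure M \<and> emeasure M (- age_range G) = 0"

definition S0 :: "(real \<Rightarrow> real) \<Rightarrow> (real \<Rightarrow> real) \<Rightarrow> (real measure \<times> real measure \<times> real) set" where
  "S0 Gs Gr = {(\<eta>, \<nu>, x).
     finite_measure_on Gr \<eta> \<and> finite_measure_on Gs \<nu> \<and> 0 \<le> x \<and>
     1 - measure \<nu> (age_range Gs) = max (1 - x) 0 \<and>
     measure \<nu> (age_range Gs) + measure \<eta> (age_range Gr) = x}"

definition fluid_content :: "(real \<Rightarrow> real \<Rightarrow> real) \<Rightarrow> real \<Rightarrow> ereal \<Rightarrow> real" where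
  "fluid_content f t y = (LINT x:{x. 0 \<le> x \<and> ereal x \<le> y}|lebesgue. f t x)"

definition density_family :: "(real \<Rightarrow> real \<Rightarrow> real) \<Rightarrow> bool" where
  "density_family f \<longleftrightarrow>
     (\<forall>t\<ge>0. (\<forall>x\<ge>0. 0 \<le> f t x) \<and> set_integrable lebesgue {0..} (f t))"

text \<open>
  Instantaneous rate at which the content with density \<open>f(t,\<cdot>)\<close> is removed by the hazard rate of
  \<open>G\<close>: the service completion rate \<open>\<sigma>\<close> for \<open>f = b\<close> and the abandonment rate \<open>\<alpha>\<close> for \<open>f = q\<close>.
  It may be infinite at individual times, hence takes values in \<^typ>\<open>ennreal\<close>.
\<close>

definition loss_rate ::
  "(real \<Rightarrow> real) \<Rightarrow> (real \<Rightarrow> real) \<Rightarrow> (real \<Rightarrow> real \<Rightarrow> real) \<Rightarrow> real \<Rightarrow> ennreal" where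
  "loss_rate G g f t = (\<integral>\<^sup>+x\<in>age_range G. ennreal (f t x * hazard G g x) \<partial>lebesgue)"

text \<open>
  The support condition is imposed at all times: the evolution equation leaves \<open>f(t,x)\<close>
  unconstrained for \<open>x \<ge> t + H\<close>, where no fluid can be present.
\<close>

definition ages_along :: "(real \<Rightarrow> real) \<Rightarrow> (real \<Rightarrow> real \<Rightarrow> real) \<Rightarrow> bool" where
  "ages_along G f \<longleftrightarrow>
     (\<forall>t\<ge>0. \<forall>x\<ge>0. x \<notin> age_range G \<longrightarrow> f t x = 0) \<and>
     (\<forall>t\<ge>0. \<forall>u>0. \<forall>x\<in>age_range G. f (t + u) (x + u) = f t x * ((1 - G (x + u)) / (1 - G x)))"

text \<open>
  Ages \<open>x = 0\<close> are excluded from the relation between \<open>q\<close> and \<open>qt\<close>, here and in the initial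
  condition, because \<open>q(t,0)\<close> and \<open>qt(t,0)\<close> are prescribed separately and differ in general when
  the queue is empty. The boundary may be infinite, as is needed when \<open>q(t,\<cdot>) = qt(t,\<cdot>)\<close> has
  unbounded support.
\<close>

definition queue_boundary ::
  "(real \<Rightarrow> real \<Rightarrow> real) \<Rightarrow> (real \<Rightarrow> real \<Rightarrow> real) \<Rightarrow> (real \<Rightarrow> ereal) \<Rightarrow> bool" where
  "queue_boundary qt q w \<longleftrightarrow>
     (\<forall>t\<ge>0. 0 \<le> w t \<and> fluid_content qt t (w t) = fluid_content q t \<infinity> \<and>
        (\<forall>x>0. (ereal x \<le> w t \<longrightarrow> q t x = qt t x) \<and> (w t < ereal x \<longrightarrow> q t x = 0)))"

text \<open>
  In \<open>whitt_model\<close>, the implication from a nonempty queue to busy servers is what makes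
  the case distinctions for \<open>b(t,0)\<close> and \<open>q(t,0)\<close> the same three exclusive regimes.
\<close>

definition whitt_model ::
  "(real \<Rightarrow> real) \<Rightarrow> (real \<Rightarrow> real) \<Rightarrow> (real \<Rightarrow> real) \<Rightarrow> (real \<Rightarrow> real) \<Rightarrow> (real \<Rightarrow> real) \<Rightarrow>
   (real \<Rightarrow> real \<Rightarrow> real) \<Rightarrow> (real \<Rightarrow> real \<Rightarrow> real) \<Rightarrow> (real \<Rightarrow> real \<Rightarrow> real) \<Rightarrow> bool" where
  "whitt_model Gs gs Gr gr lam b qt q \<longleftrightarrow>
     density_family b \<and> density_family qt \<and> density_family q \<and>
     (\<forall>t\<ge>0. \<forall>y\<ge>0. fluid_content b t y \<le> 1) \<and>
     (\<forall>x>0. q 0 x = qt 0 x) \<and>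
     ages_along Gs b \<and>
     ages_along Gr qt \<and>
     (\<exists>w. queue_boundary qt q w) \<and>
     (\<forall>t\<ge>0. fluid_content q t \<infinity> > 0 \<longrightarrow> fluid_content b t \<infinity> = 1) \<and>
     (\<forall>t\<ge>0.
        (fluid_content b t \<infinity> < 1 \<longrightarrow> b t 0 = lam t) \<and>
        (fluid_content b t \<infinity> = 1 \<and> fluid_content q t \<infinity> = 0 \<longrightarrow>
           ennreal (b t 0) = min (loss_rate Gs gs b t) (ennreal (lam t))) \<and>
        (fluid_content b t \<infinity> = 1 \<and> fluid_content q t \<infinity> > 0 \<longrightarrow>
           ennreal (b t 0) = loss_rate Gs gs b t)) \<and>
     (\<forall>t\<ge>0. qt t 0 = lam t) \<and>
     (\<forall>t\<ge>0.
        (fluid_content q t \<infinity> > 0 \<longrightarrow> q t 0 = lam t) \<and>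
        (fluid_content b t \<infinity> = 1 \<and> fluid_content q t \<infinity> = 0 \<longrightarrow>
           ennreal (q t 0) = ennreal (lam t) - min (loss_rate Gs gs b t) (ennreal (lam t))) \<and>
        (fluid_content b t \<infinity> < 1 \<longrightarrow> q t 0 = 0)) \<and>
     (\<lambda>s. b s 0) \<in> borel_measurable (lebesgue_on {0..}) \<and>
     loss_rate Gr gr q \<in> borel_measurable (lebesgue_on {0..}) \<and>
     (\<forall>t\<ge>0. ennreal (arrivals lam t) + ennreal (fluid_content q 0 \<infinity>) =
        ennreal (fluid_content q t \<infinity>) + (\<integral>\<^sup>+s\<in>{0..t}. ennreal (b s 0) \<partial>lebesgue)
          + (\<integral>\<^sup>+s\<in>{0..t}. loss_rate Gr gr q s \<partial>lebesgue))"

definition departure_rate ::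
  "(real \<Rightarrow> real) \<Rightarrow> (real \<Rightarrow> real) \<Rightarrow> (real \<Rightarrow> real measure) \<Rightarrow> real \<Rightarrow> ennreal" where
  "departure_rate Gs gs \<nu> s = (\<integral>\<^sup>+x\<in>age_range Gs. ennreal (hazard Gs gs x) \<partial>\<nu> s)"

definition departures ::
  "(real \<Rightarrow> real) \<Rightarrow> (real \<Rightarrow> real) \<Rightarrow> (real \<Rightarrow> real measure) \<Rightarrow> real \<Rightarrow> ennreal" where
  "departures Gs gs \<nu> t = (\<integral>\<^sup>+s\<in>{0..t}. departure_rate Gs gs \<nu> s \<partial>lebesgue)"

definition service_entries ::
  "(real \<Rightarrow> real) \<Rightarrow> (real \<Rightarrow> real) \<Rightarrow> (real \<Rightarrow> real measure) \<Rightarrow> real \<Rightarrow> real" where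
  "service_entries Gs gs \<nu> t =
     measure (\<nu> t) (age_range Gs) + enn2real (departures Gs gs \<nu> t) - measure (\<nu> 0) (age_range Gs)"

definition queue_length :: "(real \<Rightarrow> real) \<Rightarrow> real \<Rightarrow> real" where
  "queue_length X t = max (X t - 1) 0"

definition queue_front ::
  "(real \<Rightarrow> real) \<Rightarrow> (real \<Rightarrow> real measure) \<Rightarrow> (real \<Rightarrow> real) \<Rightarrow> real \<Rightarrow> ereal" where
  "queue_front Gr \<eta> X s =
     Inf (ereal ` {x \<in> age_range Gr. measure (\<eta> s) {0..x} \<ge> queue_length X s})"

text \<open>
  The hazard rate is integrated over \<open>[0,\<chi>(s)]\<close>, intersected with \<open>[0,H)\<close> on which it is
  defined and \<open>\<eta>\<^sub>s\<close> is concentrated.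
\<close>

definition reneging_rate ::
  "(real \<Rightarrow> real) \<Rightarrow> (real \<Rightarrow> real) \<Rightarrow> (real \<Rightarrow> real measure) \<Rightarrow> (real \<Rightarrow> real) \<Rightarrow> real \<Rightarrow> ennreal" where
  "reneging_rate Gr gr \<eta> X s =
     (\<integral>\<^sup>+x\<in>{x \<in> age_range Gr. ereal x \<le> queue_front Gr \<eta> X s}. ennreal (hazard Gr gr x) \<partial>\<eta> s)"

definition reneged ::
  "(real \<Rightarrow> real) \<Rightarrow> (real \<Rightarrow> real) \<Rightarrow> (real \<Rightarrow> real measure) \<Rightarrow> (real \<Rightarrow> real) \<Rightarrow> real \<Rightarrow> ennreal" where
  "reneged Gr gr \<eta> X t = (\<integral>\<^sup>+s\<in>{0..t}. reneging_rate Gr gr \<eta> X s \<partial>lebesgue)"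

text \<open>
  Measure \<open>dK\<close> of a nondecreasing right-continuous \<open>K\<close> on the half-line. Extending by zero to
  the left means that \<open>dK\<close> has mass \<open>K(0)\<close> at \<open>0\<close>, which vanishes for \<open>service_entries\<close>.
\<close>

definition stieltjes :: "(real \<Rightarrow> real) \<Rightarrow> real measure" where
  "stieltjes K = interval_measure (\<lambda>s. if s < 0 then 0 else K s)"

text \<open>
  The measurability, finiteness, monotonicity and right-continuity clauses are the conditions
  under which the cumulative processes and the Stieltjes integral are meaningful.
\<close>

definition kang_ramanan_model ::
  "(real \<Rightarrow> real) \<Rightarrow> (real \<Rightarrow> real) \<Rightarrow> (real \<Rightarrow> real) \<Rightarrow> (real \<Rightarrow> real) \<Rightarrow> (real \<Rightarrow> real) \<Rightarrow>
   (real \<Rightarrow> real measure) \<Rightarrow> (real \<Rightarrow> real measure) \<Rightarrow> (real \<Rightarrow> real) \<Rightarrow> bool" where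
  "kang_ramanan_model Gs gs Gr gr lam \<eta> \<nu> X \<longleftrightarrow>
     (\<eta> 0, \<nu> 0, X 0) \<in> S0 Gs Gr \<and>
     (\<forall>t\<ge>0. finite_measure_on Gr (\<eta> t) \<and> finite_measure_on Gs (\<nu> t)) \<and>
     departure_rate Gs gs \<nu> \<in> borel_measurable (lebesgue_on {0..}) \<and>
     reneging_rate Gr gr \<eta> X \<in> borel_measurable (lebesgue_on {0..}) \<and>
     (\<forall>t\<ge>0. departures Gs gs \<nu> t < \<infinity> \<and> reneged Gr gr \<eta> X t < \<infinity>) \<and>
     mono_on {0..} (service_entries Gs gs \<nu>) \<and>
     (\<forall>t\<ge>0. continuous (at_right t) (service_entries Gs gs \<nu>)) \<and>
     (\<forall>\<psi> :: real \<Rightarrow> real. continuous_on {0..} \<psi> \<and> bounded (\<psi> ` {0..}) \<longrightarrow>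
       (\<forall>t\<ge>0.
         (LINT x:{0..}|\<eta> t. \<psi> x) =
           (LINT x:age_range Gr|\<eta> 0. \<psi> (x + t) * ((1 - Gr (x + t)) / (1 - Gr x)))
           + (LINT s:{0..t}|lebesgue. \<psi> (t - s) * (1 - Gr (t - s)) * lam s) \<and>
         (LINT x:{0..}|\<nu> t. \<psi> x) =
           (LINT x:age_range Gs|\<nu> 0. \<psi> (x + t) * ((1 - Gs (x + t)) / (1 - Gs x)))
           + (LINT s:{0..t}|stieltjes (service_entries Gs gs \<nu>). \<psi> (t - s) * (1 - Gs (t - s))))) \<and>
     (\<forall>t\<ge>0. arrivals lam t + queue_length X 0 =
        queue_length X t + service_entries Gs gs \<nu> t + enn2real (reneged Gr gr \<eta> X t)) \<and>
     (\<forall>t\<ge>0. measure (\<nu> t) {0..} = min (X t) 1 \<and> min (X t) 1 = 1 - max (1 - X t) 0) \<and>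
     (\<forall>t\<ge>0. queue_length X t * (1 - measure (\<nu> t) {0..}) = 0)"

definition halfline_measure_of :: "real measure \<Rightarrow> (real \<Rightarrow> real) \<Rightarrow> bool" where
  "halfline_measure_of M F \<longleftrightarrow>
     sets M = sets borel \<and> emeasure M {..<0} = 0 \<and> (\<forall>y\<ge>0. emeasure M {0..y} = ennreal (F y))"

end

theory Submission
  imports Defs
begin

text \<open>
  Both \<open>b\<close> and \<open>qt\<close> are transported along characteristics: fluid of age \<open>x \<le> t\<close> entered at time
  \<open>t - x\<close>, older fluid was present initially. Integrating a test function against this explicit
  solution gives the evolution equations, with entry rates \<open>b(s,0)\<close> and \<open>qt(s,0) = \<lambda>(s)\<close>. Taking the
  constant test function and the hazard rate shows that content plus cumulative loss equals initial
  content plus cumulative entries; for \<open>b\<close> this identifies \<open>K(t)\<close> with the integral of \<open>b(s,0)\<close> over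
  \<open>[0,t]\<close>, so \<open>dK = b(s,0) ds\<close>. The queue front \<open>\<chi>\<close> and Whitt's boundary \<open>w\<close> cut off the same mass of
  \<open>\<eta>\<^sub>s\<close>, so the reneging rates agree and the balance equation is condition (v).
\<close>

text \<open>The model controls \<open>b\<close> and \<open>qt\<close> one time at a time: each
  \<open>f t\<close> is Lebesgue integrable, but joint measurability in time and age is not given,
  and hazard integrals may be infinite at single times. The bookkeeping is therefore done with
  \<open>ennreal\<close> integrals of the explicit solution, whose two data, entry rate and initial
  density, can be replaced by Borel functions. Real-valued identities are extracted once finiteness
  is known. For \<open>b\<close> that finiteness comes from condition (v): its left-hand side is
  finite and its right-hand side is a sum of nonnegative terms, so cumulative entries and
  abandonments are finite; conservation of mass then bounds the departures. The queue density
  \<open>q\<close> is a truncation of \<open>qt\<close> at a moving boundary and not itself a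
  solution along characteristics. Its loss rate is reached by comparing two truncations of
  \<open>qt\<close>, one at \<chi> and one at \<open>w\<close>.\<close>

section \<open>Measures on the half-line\<close>

text \<open>The sets \<open>{..y}\<close> are closed under intersection and generate the Borel sets;
  since the negative axis is null, they reduce to \<open>{0..y}\<close>. Finiteness is local because
  the measure of cumulative entries may have infinite total mass.\<close>

lemma measure_eqI_halfline:
  fixes M N :: "real measure"
  assumes sets: "sets M = sets borel" "sets N = sets borel"
    and neg: "emeasure M {..<0} = 0" "emeasure N {..<0} = 0"
    and eq: "\<And>y. 0 \<le> y \<Longrightarrow> emeasure M {0..y} = emeasure N {0..y}"
    and fin: "\<And>y. 0 \<le> y \<Longrightarrow> emeasure M {0..y} < \<infinity>"
  shows "M = N"
proof -
  have cut: "emeasure L {..y} = (if 0 \<le> y then emeasure L {0..y} else 0)"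
    if "sets L = sets borel" "emeasure L {..<0} = 0" for L :: "real measure" and y
  proof (cases "0 \<le> y")
    case True
    then have "{..y} = {..<0} \<union> {0..y}" by auto
    moreover have "emeasure L ({..<0} \<union> {0..y}) = emeasure L {0..y}"
      using that by (subst Un_commute, intro emeasure_Un_null_set) (auto simp: null_sets_def)
    ultimately show ?thesis using True by simp
  next
    case False
    then have "emeasure L {..y} \<le> emeasure L {..<0}"
      using that by (intro emeasure_mono) auto
    with False that show ?thesis by simp
  qed
  let ?E = "range (\<lambda>y::real. {..y})"
  show ?thesis
  proof (rule measure_eqI_generator_eq[where A="\<lambda>n::nat. {..real n}" and E="?E" and \<Omega>=UNIV])
    show "Int_stable ?E"
      by (auto simp: Int_stable_def)
    show "sets M = sigma_sets UNIV ?E" "sets N = sigma_sets UNIV ?E"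
      unfolding sets borel_eq_atMost by auto
    show "(\<Union>n. {..real n}) = UNIV"
      by (auto intro: real_arch_simple)
    show "emeasure M X = emeasure N X" if "X \<in> ?E" for X
      using that eq cut[OF sets(1) neg(1)] cut[OF sets(2) neg(2)] by auto
    show "emeasure M {..real n} \<noteq> \<infinity>" for n
      using fin[of "real n"] cut[OF sets(1) neg(1)] by auto
  qed auto
qed

text \<open>The restriction of \<open>N\<close> to \<open>{..a+1}\<close> is finite, so its
  distribution function is right-continuous, and up to \<open>a + 1\<close> that function equals
  \<open>measure N {..s}\<close>.\<close>

lemma measure_atMost_right_continuous:
  fixes N :: "real measure"
  assumes sets: "sets N = sets borel" and fin: "\<And>y. emeasure N {..y} < \<infinity>"
  shows "continuous (at_right a) (\<lambda>s. measure N {..s})"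
proof -
  let ?N = "density N (indicator {..a+1})"
  have [measurable_cong]: "sets N = sets borel" by fact
  have em: "emeasure ?N A = emeasure N ({..a+1} \<inter> A)" if [measurable]: "A \<in> sets borel" for A
    by (subst emeasure_density) (auto simp: indicator_inter_arith[symmetric])
  have "finite_measure ?N"
    using fin[of "a+1"] em[of UNIV] sets_eq_imp_space_eq[OF sets] by (intro finite_measureI) auto
  then interpret finite_borel_measure ?N
    by (simp add: finite_borel_measure_def finite_borel_measure_axioms_def sets)
  have eq: "cdf ?N s = measure N {..s}" if "s \<le> a + 1" for s
  proof -
    have "{..a+1} \<inter> {..s} = {..s}" using that by auto
    then show ?thesis by (simp add: cdf_def measure_def em)
  qed
  have "(cdf ?N \<longlongrightarrow> cdf ?N a) (at_right a)"
    using cdf_is_right_cont by (simp add: continuous_within)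
  moreover have "\<forall>\<^sub>F s in at_right a. cdf ?N s = measure N {..s}"
    using eventually_at_right_real[of a "a+1"] by (rule eventually_mono) (auto simp: eq)
  ultimately have "((\<lambda>s. measure N {..s}) \<longlongrightarrow> cdf ?N a) (at_right a)"
    by (rule Lim_transform_eventually)
  then show ?thesis
    by (simp add: continuous_within eq)
qed

lemma stieltjes_eq:
  fixes N :: "real measure"
  assumes sets: "sets N = sets borel" and neg: "emeasure N {..0} = 0"
    and fin: "\<And>y. emeasure N {..y} < \<infinity>"
    and K: "\<And>s. 0 \<le> s \<Longrightarrow> K s = measure N {..s}"
  shows "stieltjes K = N"
proof -
  have null: "emeasure N {..s} = 0" if "s \<le> 0" for s
  proof -
    have "emeasure N {..s} \<le> emeasure N {..0}"
      using sets that by (intro emeasure_mono) auto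
    with neg show ?thesis by simp
  qed
  have F: "(\<lambda>s. if s < 0 then 0 else K s) = (\<lambda>s. measure N {..s})"
    using null K by (auto simp: measure_def fun_eq_iff)
  have mono: "measure N {..x} \<le> measure N {..y}" if "x \<le> y" for x y
    unfolding measure_def using that sets fin by (intro enn2real_mono emeasure_mono) auto
  note Ioc = emeasure_interval_measure_Ioc_eq[of "\<lambda>s. measure N {..s}", OF mono
      measure_atMost_right_continuous[OF sets fin]]
  have Iic: "emeasure (stieltjes K) {..y} = emeasure N {..y}" if "0 \<le> y" for y
  proof -
    have U: "{..y} = (\<Union>n. {- real n <.. y})"
    proof (intro equalityI subsetI)
      fix x assume "x \<in> {..y}"
      moreover obtain n where "- x < real n" using reals_Archimedean2 by blast
      ultimately show "x \<in> (\<Union>n. {- real n <.. y})" by (intro UN_I[of n]) auto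
    qed auto
    have "emeasure (stieltjes K) (\<Union>n. {- real n <.. y}) = (SUP n. emeasure (stieltjes K) {- real n <.. y})"
    proof (rule SUP_emeasure_incseq[symmetric])
      show "range (\<lambda>n. {- real n<..y}) \<subseteq> sets (stieltjes K)"
        by (auto simp: stieltjes_def)
      show "incseq (\<lambda>n. {- real n<..y})"
        by (rule incseq_SucI) auto
    qed
    \<comment> \<open>\<open>N\<close> vanishes on \<open>{..0}\<close>, so each of these intervals
      already carries the mass of the whole \<open>{..y}\<close> and the supremum is over a
      constant.\<close>
    also have "\<dots> = (SUP n::nat. emeasure N {..y})"
    proof (rule SUP_cong[OF refl])
      fix n :: nat
      have "measure N {..- real n} = 0"
        using null[of "- real n"] by (simp add: measure_def)
      moreover have "emeasure N {..y} = ennreal (measure N {..y})"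
        using fin[of y] by (intro emeasure_eq_ennreal_measure) auto
      ultimately show "emeasure (stieltjes K) {- real n <.. y} = emeasure N {..y}"
        unfolding stieltjes_def F by (subst Ioc) (use that in auto)
    qed
    finally show ?thesis unfolding U[symmetric] by simp
  qed
  have split: "emeasure L {0..y} = emeasure L {..y}" "emeasure L {..<0} = 0"
    if "sets L = sets borel" "emeasure L {..0} = 0" "0 \<le> y" for L :: "real measure" and y
  proof -
    have "emeasure L {..<0} \<le> emeasure L {..0}"
      using that by (intro emeasure_mono) auto
    then show *: "emeasure L {..<0} = 0" using that by simp
    have "{..y} = {..<0} \<union> {0..y}" using that by auto
    moreover have "emeasure L ({..<0} \<union> {0..y}) = emeasure L {0..y}"
      using that * by (subst Un_commute, intro emeasure_Un_null_set) (auto simp: null_sets_def)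
    ultimately show "emeasure L {0..y} = emeasure L {..y}" by simp
  qed
  have sK: "sets (stieltjes K) = sets borel" by (simp add: stieltjes_def)
  have nK: "emeasure (stieltjes K) {..0} = 0" using Iic[of 0] neg by simp
  show ?thesis
  proof (rule measure_eqI_halfline[OF sK sets])
    show "emeasure (stieltjes K) {..<0} = 0" "emeasure N {..<0} = 0"
      using split(2)[OF sK nK, of 0] split(2)[OF sets neg, of 0] by auto
    show "emeasure (stieltjes K) {0..y} = emeasure N {0..y}"
      "emeasure (stieltjes K) {0..y} < \<infinity>" if "0 \<le> y" for y
      using split(1)[OF sK nK that] split(1)[OF sets neg that] Iic[OF that] fin[of y] by auto
  qed
qed

section \<open>Distributions with a density\<close>

lemma dist_with_density_cdf:
  assumes "dist_with_density G g"
  shows mono_dist: "mono G" and borel_dist: "G \<in> borel_measurable borel"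
    and dist_le_1: "G x \<le> 1" and dist_0: "G 0 = 0"
    and age_range_iff: "x \<in> age_range G \<longleftrightarrow> 0 \<le> x \<and> G x < 1"
    and age_0: "0 \<in> age_range G" and borel_age_range: "age_range G \<in> sets borel"
proof -
  obtain M where M: "real_distribution M" "G = cdf M"
    using assms by (auto simp: dist_with_density_def)
  interpret real_distribution M by fact
  show m: "mono G" by (auto simp: M mono_def cdf_nondecreasing)
  then show [measurable]: "G \<in> borel_measurable borel" by (rule borel_measurable_mono)
  show le: "G x \<le> 1" for x by (simp add: M cdf_bounded_prob)
  have "\<forall>x\<ge>0. G x = (LINT y:{0..x}|lborel. g y)"
    using assms unfolding dist_with_density_def by (elim conjE)
  then have "G 0 = (LINT y:{0..0}|lborel. g y)" by simp
  also have "\<dots> = 0"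
    unfolding set_lebesgue_integral_def
  proof (rule integral_eq_zero_AE)
    show "AE y in lborel. indicator {0..0} y *\<^sub>R g y = 0"
      using AE_lborel_singleton[of "0::real"] by eventually_elim auto
  qed
  finally show G0: "G 0 = 0" .
  have rc: "(G \<longlongrightarrow> G a) (at_right a)" for a
    using cdf_is_right_cont[of a] by (simp add: M continuous_within)
  have iff: "x \<in> age_range G \<longleftrightarrow> 0 \<le> x \<and> G x < 1" for x
  proof
    assume "x \<in> age_range G"
    then have x: "0 \<le> x" "ereal x < right_end G" by (auto simp: age_range_def)
    have "G x \<noteq> 1"
    proof
      assume "G x = 1"
      then have "right_end G \<le> ereal x"
        using x unfolding right_end_def by (intro Inf_lower) auto
      with x show False by simp
    qed
    with le[of x] x show "0 \<le> x \<and> G x < 1" by simp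
  next
    \<comment> \<open>Right-continuity gives an interval right of \<open>x\<close> on which
      \<open>G\<close> stays below 1. By monotonicity no point left of \<open>z\<close> reaches 1,
      so the infimum is at least \<open>z\<close>, strictly beyond \<open>x\<close>.\<close>
    assume x: "0 \<le> x \<and> G x < 1"
    then have "\<forall>\<^sub>F y in at_right x. G y < 1"
      using rc[of x] by (intro order_tendstoD) auto
    then obtain z where z: "x < z" "\<And>y. x < y \<Longrightarrow> y < z \<Longrightarrow> G y < 1"
      unfolding eventually_at_right_field by auto
    have "ereal z \<le> right_end G"
      unfolding right_end_def
    proof (rule Inf_greatest, clarify)
      fix y assume y: "0 \<le> y" "G y = 1"
      have "x < y" using monoD[OF m, of y x] x y by (cases "x < y") auto
      with z(2)[of y] y show "ereal z \<le> ereal y" by (cases "y < z") auto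
    qed
    moreover have "ereal x < ereal z" using z by simp
    ultimately have "ereal x < right_end G" by (rule order.strict_trans2[rotated])
    with x show "x \<in> age_range G" by (auto simp: age_range_def)
  qed
  show "x \<in> age_range G \<longleftrightarrow> 0 \<le> x \<and> G x < 1" by (rule iff)
  show "0 \<in> age_range G" by (simp add: iff G0)
  have "age_range G = {x. 0 \<le> x \<and> G x < 1}" by (auto simp: iff)
  also have "\<dots> \<in> sets borel" by measurable
  finally show "age_range G \<in> sets borel" .
qed

lemma dist_with_density_integral:
  assumes "dist_with_density G g"
  shows density_integrable: "set_integrable lborel {0..} g"
    and density_integral: "0 \<le> x \<Longrightarrow> G x = (LINT y:{0..x}|lborel. g y)"
    and density_nonneg: "0 \<le> x \<Longrightarrow> 0 \<le> g x"
  using assms unfolding dist_with_density_def by simp_all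

lemma borel_density_fun:
  assumes "dist_with_density G g"
  shows "(\<lambda>x. indicator (age_range G) x * g x) \<in> borel_measurable borel"
proof -
  have [measurable]: "(\<lambda>x. indicator {0..} x * g x) \<in> borel_measurable borel"
    using density_integrable[OF assms] by (simp add: set_integrable_def borel_measurable_integrable)
  note [measurable] = borel_age_range[OF assms]
  have "(\<lambda>x. indicator (age_range G) x * (indicator {0..} x * g x)) \<in> borel_measurable borel"
    by measurable
  also have "(\<lambda>x. indicator (age_range G) x * (indicator {0..} x * g x))
      = (\<lambda>x. indicator (age_range G) x * g x)"
    using age_range_iff[OF assms] by (auto simp: indicator_def fun_eq_iff)
  finally show ?thesis .
qed

lemma nn_integral_density_Ioc:
  assumes dist: "dist_with_density G g" and ab: "0 \<le> a" "a \<le> b"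
  shows "(\<integral>\<^sup>+x. ennreal (g x) * indicator {a<..b} x \<partial>lborel) = ennreal (G b - G a)"
proof -
  note int = density_integrable[OF dist] and G = density_integral[OF dist]
    and g = density_nonneg[OF dist]
  have sub: "set_integrable lborel {a<..b} g" "set_integrable lborel {0..a} g"
    using ab by (auto intro!: set_integrable_subset[OF int])
  have "(LINT y:{0..b}|lborel. g y) = (LINT y:{0..a} \<union> {a<..b}|lborel. g y)"
    using ab by (intro arg_cong[where f="\<lambda>A. set_lebesgue_integral lborel A g"]) auto
  also have "\<dots> = (LINT y:{0..a}|lborel. g y) + (LINT y:{a<..b}|lborel. g y)"
    using sub by (intro set_integral_Un) auto
  finally have "(LINT y:{a<..b}|lborel. g y) = G b - G a"
    using G ab by simp
  moreover have "(\<integral>\<^sup>+x. ennreal (indicator {a<..b} x *\<^sub>R g x) \<partial>lborel) = ennreal (LINT y:{a<..b}|lborel. g y)"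
    unfolding set_lebesgue_integral_def using sub g ab
    by (intro nn_integral_eq_integral) (auto simp: set_integrable_def indicator_def)
  moreover have "(\<lambda>x. ennreal (indicator {a<..b} x *\<^sub>R g x)) = (\<lambda>x. ennreal (g x) * indicator {a<..b} x)"
    by (auto simp: indicator_def)
  ultimately show ?thesis by simp
qed

lemma right_end_nonneg: "0 \<le> right_end G"
  unfolding right_end_def by (intro Inf_greatest) auto

text \<open>Beyond a finite right end \<open>h\<close> the distribution function stays at 1, so the
  nonnegative \<open>g\<close> integrates to 0 over every \<open>{h<..h + real n}\<close>. Hence
  integrating over the age range only, as the hazard rate requires, loses none of the mass of
  \<open>g\<close>.\<close>

lemma AE_density_zero_off_age_range:
  assumes dist: "dist_with_density G g"
  shows "AE x in lborel. 0 \<le> x \<longrightarrow> x \<notin> age_range G \<longrightarrow> g x = 0"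
proof (cases "right_end G")
  case (real h)
  with right_end_nonneg[of G] have h: "0 \<le> h" by simp
  have "h \<notin> age_range G" by (simp add: age_range_def real)
  then have G1: "G x = 1" if "h \<le> x" for x
    using age_range_iff[OF dist, of h] h monoD[OF mono_dist[OF dist] that] dist_le_1[OF dist, of x]
    by auto
  note int = density_integrable[OF dist] and g = density_nonneg[OF dist]
  have "AE x in lborel. x \<in> {h<..h + real n} \<longrightarrow> g x = 0" for n
  proof -
    have "set_integrable lborel {h<..h + real n} g"
      using h by (intro set_integrable_subset[OF int]) auto
    then have "(\<lambda>x. indicator {h<..h + real n} x *\<^sub>R g x) \<in> borel_measurable lborel"
      unfolding set_integrable_def by (rule borel_measurable_integrable)
    then have m: "(\<lambda>x. ennreal (g x) * indicator {h<..h + real n} x) \<in> borel_measurable lborel"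
      by (rule measurable_compose[OF _ measurable_ennreal, THEN measurable_cong[THEN iffD1, rotated]])
        (auto simp: indicator_def)
    have "(\<integral>\<^sup>+x. ennreal (g x) * indicator {h<..h + real n} x \<partial>lborel) = 0"
      using nn_integral_density_Ioc[OF dist h, of "h + real n"] by (simp add: G1)
    then have "AE x in lborel. ennreal (g x) * indicator {h<..h + real n} x = 0"
      using nn_integral_0_iff_AE[OF m] by simp
    then show ?thesis
    proof eventually_elim
      case (elim x)
      then show ?case
        using g[of x] h by (auto simp: indicator_def ennreal_eq_0_iff intro: antisym)
    qed
  qed
  then have "AE x in lborel. \<forall>n. x \<in> {h<..h + real n} \<longrightarrow> g x = 0"
    by (subst AE_all_countable) blast
  then show ?thesis
    using AE_lborel_singleton[of h]
  proof eventually_elim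
    case (elim x)
    obtain n where "x - h < real n" using reals_Archimedean2 by blast
    then have "x \<le> h + real n" by simp
    with elim show ?case by (auto simp: age_range_def real)
  qed
next
  case PInf
  then show ?thesis by (auto simp: age_range_def)
next
  case MInf
  then show ?thesis using right_end_nonneg[of G] by simp
qed

text \<open>This is the survival function times the hazard rate (see
  \<open>hazard_loss_density\<close>): the rate of loss at age \<open>x\<close> per unit of fluid
  that entered. Its vanishing at negative ages makes the later convolutions causal.\<close>

definition loss_density :: "(real \<Rightarrow> real) \<Rightarrow> (real \<Rightarrow> real) \<Rightarrow> real \<Rightarrow> ennreal" where
  "loss_density G g x = ennreal (indicator (age_range G) x * g x)"

lemma nn_integral_loss_density_Icc:
  assumes dist: "dist_with_density G g" and ab: "0 \<le> a" "a \<le> b"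
  shows "(\<integral>\<^sup>+x. loss_density G g x * indicator {a..b} x \<partial>lborel) = ennreal (G b - G a)"
proof -
  have "(\<integral>\<^sup>+x. loss_density G g x * indicator {a..b} x \<partial>lborel)
      = (\<integral>\<^sup>+x. ennreal (g x) * indicator {a<..b} x \<partial>lborel)"
  proof (rule nn_integral_cong_AE)
    show "AE x in lborel. loss_density G g x * indicator {a..b} x = ennreal (g x) * indicator {a<..b} x"
      using AE_density_zero_off_age_range[OF dist] AE_lborel_singleton[of a]
      by eventually_elim (use ab in \<open>auto simp: loss_density_def indicator_def\<close>)
  qed
  then show ?thesis using nn_integral_density_Ioc[OF assms] by simp
qed

section \<open>Fluid ageing at a hazard rate\<close>

definition borel_version :: "(real \<Rightarrow> real) \<Rightarrow> real \<Rightarrow> ennreal" where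
  "borel_version h = (SOME k. k \<in> borel_measurable borel \<and> (AE x in lborel. k x = ennreal (h x)))"

lemma borel_version:
  assumes "h \<in> borel_measurable lebesgue"
  shows borel_version_measurable: "borel_version h \<in> borel_measurable borel"
    and borel_version_AE: "AE x in lborel. borel_version h x = ennreal (h x)"
proof -
  have "(\<lambda>x. ennreal (h x)) \<in> borel_measurable lebesgue" using assms by simp
  from completion_ex_borel_measurable[OF this]
  obtain k where "k \<in> borel_measurable lborel" "AE x in lborel. ennreal (h x) = k x" by auto
  then have "\<exists>k. k \<in> borel_measurable borel \<and> (AE x in lborel. k x = ennreal (h x))"
    by (intro exI[of _ k]) auto
  from someI_ex[OF this] show "borel_version h \<in> borel_measurable borel"
    "AE x in lborel. borel_version h x = ennreal (h x)"
    by (simp_all add: borel_version_def)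
qed

text \<open>\<open>P\<close> need not define a measurable set, so the exceptional set is first
  enlarged to a Borel null set, whose preimage under an affine map with \<open>c \<noteq> 0\<close>
  is again null.\<close>

lemma AE_lborel_affine:
  assumes "AE x in lborel. P x" "c \<noteq> 0"
  shows "AE x in lborel. P (t + c * x :: real)"
proof -
  obtain N where N: "N \<in> null_sets lborel" "{x \<in> space lborel. \<not> P x} \<subseteq> N"
    using assms(1) by (auto simp: eventually_ae_filter)
  then have [measurable]: "N \<in> sets borel" by (auto simp: null_sets_def)
  have "AE x in lborel. x \<notin> N" using N(1) by (rule AE_not_in)
  then have "AE x in lborel. t + c * x \<notin> N"
    by (intro AE_borel_affine[where P="\<lambda>x. x \<notin> N"] assms) auto
  then show ?thesis by (rule AE_mp) (use N in auto)
qed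

lemma fluid_content_nonneg:
  assumes "density_family f" "0 \<le> t"
  shows "0 \<le> fluid_content f t y"
  unfolding fluid_content_def set_lebesgue_integral_def
  using assms by (intro integral_nonneg_AE AE_I2) (auto simp: indicator_def density_family_def)

text \<open>Shared by the fluid in service (\<open>b\<close> with \<open>Gs\<close>) and the
  potential queue (\<open>qt\<close> with \<open>Gr\<close>). Entries are finite on bounded time
  intervals, but possibly not in total.\<close>

locale ageing_fluid =
  fixes G g :: "real \<Rightarrow> real" and f :: "real \<Rightarrow> real \<Rightarrow> real"
  assumes dist: "dist_with_density G g"
    and dens_f: "density_family f"
    and ages: "ages_along G f"
    and entry_meas: "(\<lambda>s. f s 0) \<in> borel_measurable (lebesgue_on {0..})"
    and entry_finite: "\<And>t. 0 \<le> t \<Longrightarrow> (\<integral>\<^sup>+s\<in>{0..t}. ennreal (f s 0) \<partial>lebesgue) < \<infinity>"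
begin

lemmas [measurable] = borel_dist[OF dist] borel_age_range[OF dist]

lemma borel_loss_density [measurable]: "loss_density G g \<in> borel_measurable borel"
  unfolding loss_density_def using borel_density_fun[OF dist] by simp

lemma f_nonneg: "0 \<le> t \<Longrightarrow> 0 \<le> x \<Longrightarrow> 0 \<le> f t x"
  using dens_f by (auto simp: density_family_def)

lemma f_integrable: "0 \<le> t \<Longrightarrow> set_integrable lebesgue {0..} (f t)"
  using dens_f by (auto simp: density_family_def)

lemma f_solution:
  assumes "0 \<le> t" "0 \<le> x"
  shows "f t x = (if x \<le> t then f (t - x) 0 * (1 - G x) else f 0 (x - t) * ((1 - G x) / (1 - G (x - t))))"
proof -
  have zero: "f t x = 0" if "0 \<le> t" "0 \<le> x" "x \<notin> age_range G" for t x
    using ages that by (auto simp: ages_along_def)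
  have step: "f (t + u) (x + u) = f t x * ((1 - G (x + u)) / (1 - G x))"
    if "0 \<le> t" "0 \<le> u" "x \<in> age_range G" for t u x
    using ages that age_range_iff[OF dist, of x] by (cases "u = 0") (auto simp: ages_along_def)
  show ?thesis
  proof (cases "x \<le> t")
    case True
    then show ?thesis
      using step[of "t - x" x 0] assms age_0[OF dist] dist_0[OF dist] by simp
  next
    case False
    show ?thesis
    proof (cases "x - t \<in> age_range G")
      case True
      then show ?thesis using step[of 0 t "x - t"] assms False by simp
    next
      \<comment> \<open>By monotonicity of \<open>G\<close>, \<open>x\<close> is outside the age
        range as well. The support condition makes both sides 0, whatever the value of the quotient
        with denominator 0.\<close>
      case no: False
      then have "x \<notin> age_range G"
        using False assms age_range_iff[OF dist] monoD[OF mono_dist[OF dist], of "x - t" x] by auto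
      with no False assms zero[of t x] zero[of 0 "x - t"] show ?thesis by simp
    qed
  qed
qed

section \<open>Explicit solution with Borel data\<close>

text \<open>
  Tonelli's theorem on \<open>lborel\<close> needs Borel measurable integrands, hence the Borel versions. The
  solution formula for \<open>f\<close> only uses the boundary and initial densities along
  translates and reflections of the half-line, so exceptional null sets stay null at every time.
\<close>

definition init :: "real \<Rightarrow> ennreal" where
  "init x = indicator ({0<..} \<inter> age_range G) x * borel_version (\<lambda>x. indicator {0..} x * f 0 x) x"

definition entry :: "real \<Rightarrow> ennreal" where
  "entry s = indicator {0..} s * borel_version (\<lambda>s. indicator {0..} s * f s 0) s"

text \<open>A sum in place of a case distinction: \<open>entry\<close> vanishes at negative times
  and \<open>init\<close> at ages up to and including 0, so at most one summand is nonzero. At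
  \<open>x = t\<close> only the entering fluid counts, hence nothing is counted twice.\<close>

definition dens :: "real \<Rightarrow> real \<Rightarrow> ennreal" where
  "dens t x = indicator {0..} x * entry (t - x) * ennreal (1 - G x)
    + init (x - t) * ennreal ((1 - G x) / (1 - G (x - t)))"

lemma lebesgue_init: "(\<lambda>x. indicator {0..} x * f 0 x) \<in> borel_measurable lebesgue"
  using f_integrable[of 0] by (simp add: set_integrable_def borel_measurable_integrable)

lemma lebesgue_entry: "(\<lambda>s. indicator {0..} s * f s 0) \<in> borel_measurable lebesgue"
  using entry_meas by (subst (asm) borel_measurable_restrict_space_iff) (auto simp: mult.commute)

lemma borel_init [measurable]: "init \<in> borel_measurable borel"
  unfolding init_def[abs_def] using borel_version_measurable[OF lebesgue_init] by measurable

lemma borel_entry [measurable]: "entry \<in> borel_measurable borel"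
  unfolding entry_def[abs_def] using borel_version_measurable[OF lebesgue_entry] by measurable

lemma borel_dens [measurable]: "dens t \<in> borel_measurable borel"
  unfolding dens_def[abs_def] by measurable

lemma init_eq_0: "x \<le> 0 \<or> x \<notin> age_range G \<Longrightarrow> init x = 0"
  by (auto simp: init_def)

lemma entry_eq_0: "s < 0 \<Longrightarrow> entry s = 0"
  by (auto simp: entry_def)

lemma AE_entry: "AE s in lborel. 0 \<le> s \<longrightarrow> entry s = ennreal (f s 0)"
  using borel_version_AE[OF lebesgue_entry] by eventually_elim (auto simp: entry_def)

lemma AE_init: "AE x in lborel. 0 < x \<longrightarrow> init x = ennreal (f 0 x)"
  using borel_version_AE[OF lebesgue_init]
proof eventually_elim
  case (elim x)
  then show ?case
    using ages by (auto simp: init_def ages_along_def indicator_def)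
qed

lemma AE_dens:
  assumes "0 \<le> t"
  shows "AE x in lborel. dens t x = ennreal (indicator {0..} x * f t x)"
  using AE_lborel_affine[OF AE_init, where c=1 and t="- t", simplified]
    AE_lborel_affine[OF AE_entry, where c="-1" and t=t, simplified]
proof eventually_elim
  case (elim x)
  note le = dist_le_1[OF dist]
  consider "x < 0" | "0 \<le> x" "x \<le> t" | "t < x" by linarith
  then show ?case
  proof cases
    case 1
    then show ?thesis using assms by (simp add: dens_def init_eq_0)
  next
    case 2
    then show ?thesis
      using elim assms le[of x] f_nonneg[of "t - x" 0] f_solution[OF assms, of x]
      by (simp add: dens_def init_eq_0 ennreal_mult)
  next
    case 3
    then show ?thesis
      using elim assms le[of x] le[of "x - t"] f_nonneg[of 0 "x - t"] f_solution[OF assms, of x]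
      by (simp add: dens_def entry_eq_0 flip: ennreal_mult)
  qed
qed

text \<open>At time 0 the single age 0 still carries \<open>entry 0\<close>, hence equality only
  almost everywhere.\<close>

lemma dens_zero: "AE x in lborel. dens 0 x = init x"
  using AE_lborel_singleton[of 0]
proof eventually_elim
  case (elim x)
  then consider "x < 0" | "0 < x" "x \<in> age_range G" | "0 < x" "x \<notin> age_range G" by linarith
  then show ?case
    using age_range_iff[OF dist, of x] by cases (auto simp: dens_def init_eq_0 entry_eq_0)
qed

lemma fluid_content_eq:
  assumes "0 \<le> t"
  shows "ennreal (fluid_content f t y) = (\<integral>\<^sup>+x. dens t x * indicator {x. ereal x \<le> y} x \<partial>lborel)"
proof -
  let ?S = "{x. 0 \<le> x \<and> ereal x \<le> y}"
  have [measurable]: "?S \<in> sets borel" by measurable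
  then have S: "?S \<in> sets lebesgue" by (simp add: sets_completionI_sets)
  then have "set_integrable lebesgue ?S (f t)"
    by (intro set_integrable_subset[OF f_integrable[OF assms]]) auto
  then have "ennreal (fluid_content f t y) = (\<integral>\<^sup>+x. ennreal (indicator ?S x *\<^sub>R f t x) \<partial>lebesgue)"
    unfolding fluid_content_def set_lebesgue_integral_def set_integrable_def
    by (intro nn_integral_eq_integral[symmetric]) (auto simp: indicator_def f_nonneg assms)
  also have "\<dots> = (\<integral>\<^sup>+x. dens t x * indicator {x. ereal x \<le> y} x \<partial>lebesgue)"
  proof (rule nn_integral_cong_AE)
    show "AE x in lebesgue. ennreal (indicator ?S x *\<^sub>R f t x) = dens t x * indicator {x. ereal x \<le> y} x"
      using AE_completion[OF AE_dens[OF assms]] by eventually_elim (auto simp: indicator_def)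
  qed
  finally show ?thesis by (simp add: nn_integral_completion)
qed

lemmas content_nonneg = fluid_content_nonneg[OF dens_f]

lemma total_content: "0 \<le> t \<Longrightarrow> ennreal (fluid_content f t \<infinity>) = (\<integral>\<^sup>+x. dens t x \<partial>lborel)"
  using fluid_content_eq[of t \<infinity>] by simp

lemma halfline_measure_eq:
  assumes "0 \<le> t" "halfline_measure_of M (\<lambda>y. fluid_content f t (ereal y))"
  shows "M = density lborel (dens t)"
proof (rule measure_eqI_halfline)
  have M: "sets M = sets borel" "emeasure M {..<0} = 0"
     "\<And>y. 0 \<le> y \<Longrightarrow> emeasure M {0..y} = ennreal (fluid_content f t (ereal y))"
    using assms by (auto simp: halfline_measure_of_def)
  then show "sets M = sets borel" "emeasure M {..<0} = 0" by auto
  have z: "dens t x = 0" if "x < 0" for x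
    using that assms by (simp add: dens_def init_eq_0)
  show "emeasure (density lborel (dens t)) {..<0} = 0"
    by (simp add: emeasure_density) (auto intro!: nn_integral_zero' AE_I2 simp: z indicator_def)
  show "emeasure M {0..y} < \<infinity>" if "0 \<le> y" for y
    using M(3)[OF that] by simp
  show "emeasure M {0..y} = emeasure (density lborel (dens t)) {0..y}" if "0 \<le> y" for y
    unfolding M(3)[OF that] fluid_content_eq[OF assms(1)]
    by (simp add: emeasure_density) (auto intro!: nn_integral_cong simp: z indicator_def)
qed simp

text \<open>Substitute \<open>s = t - x\<close> in the entering part and shift by \<open>t\<close>
  in the initial part. The choice of \<open>\<phi>\<close> yields the mass (constant 1), the loss
  rate (hazard) and the evolution equations (test functions).\<close>

lemma nn_integral_dens:
  assumes [measurable]: "\<phi> \<in> borel_measurable borel" and t: "0 \<le> t"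
  shows "(\<integral>\<^sup>+x. dens t x * \<phi> x \<partial>lborel)
    = (\<integral>\<^sup>+s. entry s * (indicator {..t} s * ennreal (1 - G (t - s)) * \<phi> (t - s)) \<partial>lborel)
      + (\<integral>\<^sup>+x. init x * (ennreal ((1 - G (x + t)) / (1 - G x)) * \<phi> (x + t)) \<partial>lborel)"
proof -
  have "(\<integral>\<^sup>+x. dens t x * \<phi> x \<partial>lborel)
    = (\<integral>\<^sup>+x. indicator {0..} x * entry (t - x) * ennreal (1 - G x) * \<phi> x \<partial>lborel)
     + (\<integral>\<^sup>+x. init (x - t) * ennreal ((1 - G x) / (1 - G (x - t))) * \<phi> x \<partial>lborel)"
    by (subst nn_integral_add[symmetric]) (auto simp: dens_def distrib_right)
  also have "(\<integral>\<^sup>+x. indicator {0..} x * entry (t - x) * ennreal (1 - G x) * \<phi> x \<partial>lborel)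
    = (\<integral>\<^sup>+s. entry s * (indicator {..t} s * ennreal (1 - G (t - s)) * \<phi> (t - s)) \<partial>lborel)"
    by (subst nn_integral_real_affine[where c="-1" and t=t])
      (auto intro!: nn_integral_cong simp: indicator_def mult.assoc)
  also have "(\<integral>\<^sup>+x. init (x - t) * ennreal ((1 - G x) / (1 - G (x - t))) * \<phi> x \<partial>lborel)
     = (\<integral>\<^sup>+x. init x * (ennreal ((1 - G (x + t)) / (1 - G x)) * \<phi> (x + t)) \<partial>lborel)"
    by (subst nn_integral_real_affine[where c=1 and t=t])
      (auto intro!: nn_integral_cong simp: mult.assoc add.commute)
  finally show ?thesis .
qed

lemma entry_cumulative:
  "(\<integral>\<^sup>+s. entry s * indicator {..t} s \<partial>lborel) = (\<integral>\<^sup>+s\<in>{0..t}. ennreal (f s 0) \<partial>lebesgue)"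
proof -
  have "(\<integral>\<^sup>+s. entry s * indicator {..t} s \<partial>lborel) = (\<integral>\<^sup>+s. entry s * indicator {..t} s \<partial>lebesgue)"
    by (simp add: nn_integral_completion)
  also have "\<dots> = (\<integral>\<^sup>+s\<in>{0..t}. ennreal (f s 0) \<partial>lebesgue)"
  proof (rule nn_integral_cong_AE)
    show "AE s in lebesgue. entry s * indicator {..t} s = ennreal (f s 0) * indicator {0..t} s"
      using AE_completion[OF AE_entry] by eventually_elim (auto simp: indicator_def entry_eq_0)
  qed
  finally show ?thesis .
qed

section \<open>The loss rate\<close>

lemma hazard_nonneg: "x \<in> age_range G \<Longrightarrow> 0 \<le> hazard G g x"
  using age_range_iff[OF dist, of x] density_nonneg[OF dist, of x] by (simp add: hazard_def)

lemma hazard_loss_density: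
  "ennreal (1 - G x) * (indicator (age_range G) x * ennreal (hazard G g x)) = loss_density G g x"
  using age_range_iff[OF dist, of x] density_nonneg[OF dist, of x]
  by (auto simp: loss_density_def indicator_def hazard_def simp flip: ennreal_mult)

lemma borel_hazard [measurable]:
  "(\<lambda>x. indicator (age_range G) x * ennreal (hazard G g x)) \<in> borel_measurable borel"
proof -
  have "(\<lambda>x. indicator (age_range G) x * ennreal (hazard G g x))
     = (\<lambda>x. ennreal (indicator (age_range G) x * g x / (1 - G x)))"
    by (auto simp: hazard_def indicator_def)
  also have "\<dots> \<in> borel_measurable borel"
    using borel_density_fun[OF dist] by measurable
  finally show ?thesis .
qed

lemma loss_rate_eq:
  assumes "0 \<le> t"
  shows "loss_rate G g f t
    = (\<integral>\<^sup>+x. dens t x * (indicator (age_range G) x * ennreal (hazard G g x)) \<partial>lborel)"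
proof -
  have "loss_rate G g f t
    = (\<integral>\<^sup>+x. dens t x * (indicator (age_range G) x * ennreal (hazard G g x)) \<partial>lebesgue)"
    unfolding loss_rate_def
  proof (rule nn_integral_cong_AE)
    show "AE x in lebesgue. ennreal (f t x * hazard G g x) * indicator (age_range G) x
        = dens t x * (indicator (age_range G) x * ennreal (hazard G g x))"
      using AE_completion[OF AE_dens[OF assms]]
    proof eventually_elim
      case (elim x)
      then show ?case
        using hazard_nonneg[of x] f_nonneg[OF assms, of x] age_range_iff[OF dist, of x]
        by (auto simp: indicator_def ennreal_mult)
    qed
  qed
  then show ?thesis by (simp add: nn_integral_completion)
qed

text \<open>The survival factor cancels the denominator of the hazard rate, which leaves the density
  of \<open>G\<close> at the current age. Time now enters only through Borel functions, so the loss
  rate is measurable in time and Tonelli applies to its time integral.\<close>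

lemma loss_rate_convolution:
  assumes "0 \<le> t"
  shows "loss_rate G g f t = (\<integral>\<^sup>+s. entry s * loss_density G g (t - s) \<partial>lborel)
    + (\<integral>\<^sup>+x. init x * ennreal (1 / (1 - G x)) * loss_density G g (x + t) \<partial>lborel)"
proof -
  have "indicator {..t} s * ennreal (1 - G (t - s)) *
      (indicator (age_range G) (t - s) * ennreal (hazard G g (t - s))) = loss_density G g (t - s)" for s
    using hazard_loss_density[of "t - s"] age_range_iff[OF dist, of "t - s"]
    by (cases "s \<le> t") (auto simp: loss_density_def)
  moreover have "init x * (ennreal ((1 - G (x + t)) / (1 - G x)) *
      (indicator (age_range G) (x + t) * ennreal (hazard G g (x + t))))
      = init x * ennreal (1 / (1 - G x)) * loss_density G g (x + t)" for x
  proof (cases "x \<in> age_range G")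
    case True
    then have "ennreal ((1 - G (x + t)) / (1 - G x)) = ennreal (1 / (1 - G x)) * ennreal (1 - G (x + t))"
      using age_range_iff[OF dist, of x] dist_le_1[OF dist, of "x + t"] by (simp flip: ennreal_mult)
    then show ?thesis by (simp add: mult.assoc hazard_loss_density)
  qed (simp add: init_eq_0)
  ultimately show ?thesis
    unfolding loss_rate_eq[OF assms] by (subst nn_integral_dens) (auto simp: assms)
qed

lemma borel_loss_rate: "loss_rate G g f \<in> borel_measurable (lebesgue_on {0..})"
proof -
  let ?L = "\<lambda>t. (\<integral>\<^sup>+s. entry s * loss_density G g (t - s) \<partial>lborel)
    + (\<integral>\<^sup>+x. init x * ennreal (1 / (1 - G x)) * loss_density G g (x + t) \<partial>lborel)"
  have "?L \<in> borel_measurable borel" by measurable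
  then have "?L \<in> borel_measurable (lebesgue_on {0..})"
    by (intro measurable_restrict_space1 measurable_completion) auto
  then show ?thesis
    by (subst measurable_cong[where g="?L"]) (auto simp: loss_rate_convolution)
qed

section \<open>Conservation of mass\<close>

text \<open>
  By Tonelli, fluid entering at \<open>s\<close> has lost the fraction \<open>G(T - s)\<close> by time \<open>T\<close>, and initial fluid
  of age \<open>x\<close> the fraction \<open>(G(x + T) - G(x)) / (1 - G(x))\<close>, exactly what is missing from the content.
\<close>

lemma conservation:
  assumes T: "0 \<le> T"
  shows "(\<integral>\<^sup>+x. dens T x \<partial>lborel) + (\<integral>\<^sup>+t\<in>{0..T}. loss_rate G g f t \<partial>lebesgue)
    = (\<integral>\<^sup>+x. init x \<partial>lborel) + (\<integral>\<^sup>+s. entry s * indicator {..T} s \<partial>lborel)"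
proof -
  note le = dist_le_1[OF dist] and mono = monoD[OF mono_dist[OF dist]]
  let ?k = "loss_density G g"
  have "(\<integral>\<^sup>+t\<in>{0..T}. loss_rate G g f t \<partial>lebesgue)
    = (\<integral>\<^sup>+t. ((\<integral>\<^sup>+s. entry s * ?k (t - s) \<partial>lborel)
    + (\<integral>\<^sup>+x. init x * ennreal (1 / (1 - G x)) * ?k (x + t) \<partial>lborel)) * indicator {0..T} t \<partial>lebesgue)"
    by (intro nn_integral_cong) (auto simp: loss_rate_convolution indicator_def)
  also have "\<dots> = (\<integral>\<^sup>+t. (\<integral>\<^sup>+s. entry s * ?k (t - s) * indicator {0..T} t \<partial>lborel) \<partial>lborel)
    + (\<integral>\<^sup>+t. (\<integral>\<^sup>+x. init x * ennreal (1 / (1 - G x)) * ?k (x + t) * indicator {0..T} t \<partial>lborel) \<partial>lborel)"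
    by (simp add: nn_integral_completion distrib_right nn_integral_add nn_integral_multc)
  also have "(\<integral>\<^sup>+t. (\<integral>\<^sup>+s. entry s * ?k (t - s) * indicator {0..T} t \<partial>lborel) \<partial>lborel)
    = (\<integral>\<^sup>+s. (\<integral>\<^sup>+t. entry s * ?k (t - s) * indicator {0..T} t \<partial>lborel) \<partial>lborel)"
    by (rule lborel_pair.Fubini') measurable
  also have "\<dots> = (\<integral>\<^sup>+s. entry s * (indicator {..T} s * ennreal (G (T - s))) \<partial>lborel)"
  proof (rule nn_integral_cong)
    fix s
    show "(\<integral>\<^sup>+t. entry s * ?k (t - s) * indicator {0..T} t \<partial>lborel)
      = entry s * (indicator {..T} s * ennreal (G (T - s)))"
    proof (cases "0 \<le> s")
      case True
      have "(\<integral>\<^sup>+t. ?k (t - s) * indicator {0..T} t \<partial>lborel)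
        = (\<integral>\<^sup>+x. ?k x * indicator {0..T} (s + x) \<partial>lborel)"
        by (subst nn_integral_real_affine[where c=1 and t=s]) auto
      \<comment> \<open>The lower limit \<open>0 \<le> s + x\<close> may be replaced by
        \<open>0 \<le> x\<close> because \<open>?k\<close> vanishes at negative ages.\<close>
      also have "\<dots> = (\<integral>\<^sup>+x. ?k x * indicator {0..T - s} x \<partial>lborel)"
        using True age_range_iff[OF dist]
        by (intro nn_integral_cong) (auto simp: indicator_def loss_density_def)
      also have "\<dots> = indicator {..T} s * ennreal (G (T - s))"
      proof (cases "s \<le> T")
        case True
        then show ?thesis
          using nn_integral_loss_density_Icc[OF dist, of 0 "T - s"] by (simp add: dist_0[OF dist])
      qed auto
      finally show ?thesis by (simp add: mult.assoc nn_integral_cmult)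
    qed (simp add: entry_eq_0)
  qed
  also have "(\<integral>\<^sup>+t. (\<integral>\<^sup>+x. init x * ennreal (1 / (1 - G x)) * ?k (x + t) * indicator {0..T} t \<partial>lborel) \<partial>lborel)
    = (\<integral>\<^sup>+x. (\<integral>\<^sup>+t. init x * ennreal (1 / (1 - G x)) * ?k (x + t) * indicator {0..T} t \<partial>lborel) \<partial>lborel)"
    by (rule lborel_pair.Fubini') measurable
  also have "\<dots> = (\<integral>\<^sup>+x. init x * ennreal ((G (x + T) - G x) / (1 - G x)) \<partial>lborel)"
  proof (rule nn_integral_cong)
    fix x
    show "(\<integral>\<^sup>+t. init x * ennreal (1 / (1 - G x)) * ?k (x + t) * indicator {0..T} t \<partial>lborel)
      = init x * ennreal ((G (x + T) - G x) / (1 - G x))"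
    proof (cases "0 < x \<and> x \<in> age_range G")
      case True
      have "(\<integral>\<^sup>+t. ?k (x + t) * indicator {0..T} t \<partial>lborel)
        = (\<integral>\<^sup>+y. ?k y * indicator {x..x + T} y \<partial>lborel)"
        by (subst nn_integral_real_affine[where c=1 and t="- x"])
          (auto intro!: nn_integral_cong simp: indicator_def)
      also have "\<dots> = ennreal (G (x + T) - G x)"
        using True T by (intro nn_integral_loss_density_Icc[OF dist]) auto
      finally show ?thesis
        using True age_range_iff[OF dist, of x] mono[of x "x + T"] T
        by (simp add: mult.assoc nn_integral_cmult flip: ennreal_mult)
    qed (auto simp: init_eq_0)
  qed
  finally have loss: "(\<integral>\<^sup>+t\<in>{0..T}. loss_rate G g f t \<partial>lebesgue)
    = (\<integral>\<^sup>+s. entry s * (indicator {..T} s * ennreal (G (T - s))) \<partial>lborel)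
      + (\<integral>\<^sup>+x. init x * ennreal ((G (x + T) - G x) / (1 - G x)) \<partial>lborel)" .
  have mass: "(\<integral>\<^sup>+x. dens T x \<partial>lborel)
    = (\<integral>\<^sup>+s. entry s * (indicator {..T} s * ennreal (1 - G (T - s))) \<partial>lborel)
      + (\<integral>\<^sup>+x. init x * ennreal ((1 - G (x + T)) / (1 - G x)) \<partial>lborel)"
    using nn_integral_dens[of "\<lambda>_. 1", OF _ T] by simp
  have "(\<integral>\<^sup>+s. entry s * (indicator {..T} s * ennreal (1 - G (T - s))) \<partial>lborel)
     + (\<integral>\<^sup>+s. entry s * (indicator {..T} s * ennreal (G (T - s))) \<partial>lborel)
     = (\<integral>\<^sup>+s. entry s * indicator {..T} s \<partial>lborel)"
    using le mono[of 0] dist_0[OF dist]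
    by (subst nn_integral_add[symmetric])
      (auto intro!: nn_integral_cong simp: indicator_def simp flip: distrib_left ennreal_plus)
  moreover have "(\<integral>\<^sup>+x. init x * ennreal ((1 - G (x + T)) / (1 - G x)) \<partial>lborel)
     + (\<integral>\<^sup>+x. init x * ennreal ((G (x + T) - G x) / (1 - G x)) \<partial>lborel)
     = (\<integral>\<^sup>+x. init x \<partial>lborel)"
  proof (subst nn_integral_add[symmetric])
    show "(\<integral>\<^sup>+x. init x * ennreal ((1 - G (x + T)) / (1 - G x))
        + init x * ennreal ((G (x + T) - G x) / (1 - G x)) \<partial>lborel) = (\<integral>\<^sup>+x. init x \<partial>lborel)"
    proof (rule nn_integral_cong)
      fix x
      show "init x * ennreal ((1 - G (x + T)) / (1 - G x))
        + init x * ennreal ((G (x + T) - G x) / (1 - G x)) = init x"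
      proof (cases "x \<in> age_range G")
        case True
        then show ?thesis
          using age_range_iff[OF dist, of x] mono[of x "x + T"] le[of "x + T"] T
          by (simp flip: distrib_left ennreal_plus add_divide_distrib)
      qed (simp add: init_eq_0)
    qed
  qed auto
  ultimately show ?thesis unfolding loss mass by (simp add: ac_simps)
qed

lemma entry_cumulative_finite: "(\<integral>\<^sup>+s. entry s * indicator {..t} s \<partial>lborel) < \<infinity>"
proof (cases "0 \<le> t")
  case True
  then show ?thesis using entry_finite by (simp add: entry_cumulative)
next
  case False
  then have "(\<lambda>s. entry s * indicator {..t} s) = (\<lambda>s. 0)"
    by (fastforce simp: fun_eq_iff indicator_def intro: entry_eq_0)
  then show ?thesis by simp
qed

section \<open>Weak form of the evolution equation\<close>

lemma finite_measure_dens: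
  assumes "0 \<le> t"
  shows "finite_measure (density lborel (dens t))"
  using total_content[OF assms]
  by (intro finite_measureI) (simp add: emeasure_density flip: total_content[OF assms])

text \<open>\<open>nn_integral_dens\<close> handles nonnegative integrands. It is applied to the
  positive parts of \<open>\<psi>\<close> and of \<open>- \<psi>\<close>, and the results are
  subtracted. This is legitimate since all weights are survival probabilities in [0,1] and the three
  measures are finite, so each part has a finite integral.\<close>

lemma weak_evolution:
  assumes \<psi>: "continuous_on {0..} \<psi>" "bounded (\<psi> ` {0..})" and t: "0 \<le> t"
  shows "(LINT x:{0..}|density lborel (dens t). \<psi> x)
    = (LINT x:age_range G|density lborel (dens 0). \<psi> (x + t) * ((1 - G (x + t)) / (1 - G x)))
      + (LINT s:{0..t}|density lborel entry. \<psi> (t - s) * (1 - G (t - s)))"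
proof -
  note le = dist_le_1[OF dist] and mono = monoD[OF mono_dist[OF dist]]
  have le0: "0 \<le> G x" if "0 \<le> x" for x using mono[OF that] dist_0[OF dist] by simp
  \<comment> \<open>Nothing is known about \<open>\<psi>\<close> at negative arguments, so it is cut
    off at 0 before measurability is claimed.\<close>
  have bm: "(\<lambda>x. indicator {0..} x * \<psi> x) \<in> borel_measurable borel"
    using borel_measurable_continuous_on_indicator[OF _ \<psi>(1)] by simp
  obtain C where C: "\<And>x. 0 \<le> x \<Longrightarrow> \<bar>\<psi> x\<bar> \<le> C"
    using \<psi>(2) by (auto simp: bounded_iff)
  then have C0: "0 \<le> C" using abs_ge_zero order_trans by blast
  let ?M = "density lborel (dens t)" and ?I = "density lborel (dens 0)"
  \<comment> \<open>The entry measure may be infinite; cut at \<open>t\<close> it is finite, and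
    bounded integrands become integrable.\<close>
  let ?N = "density lborel (\<lambda>s. entry s * indicator {..t} s)"
  interpret M: finite_measure ?M by (rule finite_measure_dens[OF t])
  interpret I: finite_measure ?I by (rule finite_measure_dens) simp
  interpret N: finite_measure ?N
    using entry_cumulative_finite[of t] by (intro finite_measureI) (simp add: emeasure_density)
  let ?a = "\<lambda>p x. indicator {0..} x * p x :: real"
  let ?b = "\<lambda>p x. indicator (age_range G) x * (?a p (x + t) * ((1 - G (x + t)) / (1 - G x)))"
  let ?c = "\<lambda>p s. indicator {0..t} s * (?a p (t - s) * (1 - G (t - s)))"
  \<comment> \<open>As \<open>ennreal\<close> sends negative reals to 0 and the weights are
    nonnegative, this is the identity for the positive part of \<open>p\<close>.\<close>
  have nn: "(\<integral>\<^sup>+x. ennreal (?a p x) \<partial>?M) = (\<integral>\<^sup>+x. ennreal (?b p x) \<partial>?I) + (\<integral>\<^sup>+s. ennreal (?c p s) \<partial>?N)"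
    if [measurable]: "?a p \<in> borel_measurable borel" for p
  proof -
    have "(\<integral>\<^sup>+x. ennreal (?a p x) \<partial>?M) = (\<integral>\<^sup>+x. dens t x * ennreal (?a p x) \<partial>lborel)"
      by (simp add: nn_integral_density)
    also have "\<dots> = (\<integral>\<^sup>+s. entry s * (indicator {..t} s * ennreal (1 - G (t - s)) * ennreal (?a p (t - s))) \<partial>lborel)
      + (\<integral>\<^sup>+x. init x * (ennreal ((1 - G (x + t)) / (1 - G x)) * ennreal (?a p (x + t))) \<partial>lborel)"
      by (rule nn_integral_dens[OF _ t]) measurable
    also have "(\<integral>\<^sup>+x. init x * (ennreal ((1 - G (x + t)) / (1 - G x)) * ennreal (?a p (x + t))) \<partial>lborel)
      = (\<integral>\<^sup>+x. dens 0 x * ennreal (?b p x) \<partial>lborel)"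
    proof (rule nn_integral_cong_AE)
      show "AE x in lborel. init x * (ennreal ((1 - G (x + t)) / (1 - G x)) * ennreal (?a p (x + t)))
         = dens 0 x * ennreal (?b p x)"
        using dens_zero
      proof eventually_elim
        case (elim x)
        have "ennreal (?b p x) = ennreal ((1 - G (x + t)) / (1 - G x)) * ennreal (?a p (x + t))"
          if "x \<in> age_range G"
          using that age_range_iff[OF dist, of x] le[of "x + t"]
            ennreal_mult'[of "(1 - G (x + t)) / (1 - G x)" "?a p (x + t)"]
          by (simp add: mult.commute)
        then show ?case using elim by (cases "x \<in> age_range G") (auto simp: init_eq_0)
      qed
    qed
    also have "\<dots> = (\<integral>\<^sup>+x. ennreal (?b p x) \<partial>?I)"
      by (simp add: nn_integral_density)
    also have "(\<integral>\<^sup>+s. entry s * (indicator {..t} s * ennreal (1 - G (t - s)) * ennreal (?a p (t - s))) \<partial>lborel)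
      = (\<integral>\<^sup>+s. entry s * indicator {..t} s * ennreal (?c p s) \<partial>lborel)"
    proof (rule nn_integral_cong)
      fix s
      show "entry s * (indicator {..t} s * ennreal (1 - G (t - s)) * ennreal (?a p (t - s)))
        = entry s * indicator {..t} s * ennreal (?c p s)"
        using le[of "t - s"]
        by (cases "0 \<le> s") (auto simp: indicator_def entry_eq_0 ennreal_mult' mult.commute)
    qed
    also have "\<dots> = (\<integral>\<^sup>+s. ennreal (?c p s) \<partial>?N)"
      by (simp add: nn_integral_density)
    finally show ?thesis by (simp add: add.commute)
  qed
  have bounds: "\<bar>?a \<psi> x\<bar> \<le> C" "\<bar>?b \<psi> x\<bar> \<le> C" "\<bar>?c \<psi> x\<bar> \<le> C" for x
  proof -
    show a: "\<bar>?a \<psi> x\<bar> \<le> C" for x using C[of x] C0 by (auto simp: indicator_def)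
    have prod: "\<bar>u * v\<bar> \<le> C" if "\<bar>u\<bar> \<le> C" "0 \<le> v" "v \<le> 1" for u v :: real
      using mult_mono[of "\<bar>u\<bar>" C "\<bar>v\<bar>" 1] that C0 by (simp add: abs_mult)
    show "\<bar>?b \<psi> x\<bar> \<le> C"
    proof (cases "x \<in> age_range G")
      case True
      then have "0 \<le> (1 - G (x + t)) / (1 - G x)" "(1 - G (x + t)) / (1 - G x) \<le> 1"
        using age_range_iff[OF dist, of x] le[of "x + t"] mono[of x "x + t"] t by auto
      from prod[OF a this] show ?thesis using True by simp
    qed (simp add: C0)
    show "\<bar>?c \<psi> x\<bar> \<le> C"
      using prod[OF a[of "t - x"], of "1 - G (t - x)"] le[of "t - x"] le0[of "t - x"] C0
      by (cases "x \<in> {0..t}") auto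
  qed
  have ints: "integrable ?M (?a \<psi>)" "integrable ?I (?b \<psi>)" "integrable ?N (?c \<psi>)"
    using bounds bm
    by (auto intro!: M.integrable_const_bound[where B=C] I.integrable_const_bound[where B=C]
        N.integrable_const_bound[where B=C])
  have finp: "(\<integral>\<^sup>+x. ennreal (h x) \<partial>L) < \<infinity>" if "integrable L h" for L :: "real measure" and h
    using integrableD(2)[OF that] by (simp add: less_top)
  have minus: "?a (\<lambda>x. - \<psi> x) = (\<lambda>x. - ?a \<psi> x)" "?b (\<lambda>x. - \<psi> x) = (\<lambda>x. - ?b \<psi> x)"
      "?c (\<lambda>x. - \<psi> x) = (\<lambda>x. - ?c \<psi> x)" by (auto simp: fun_eq_iff)
  have "integral\<^sup>L ?M (?a \<psi>) = integral\<^sup>L ?I (?b \<psi>) + integral\<^sup>L ?N (?c \<psi>)"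
    using nn[OF bm] nn[of "\<lambda>x. - \<psi> x"] bm ints
      finp[OF ints(2)] finp[OF ints(3)]
      finp[OF integrable_minus[OF ints(2)]] finp[OF integrable_minus[OF ints(3)]]
    unfolding minus by (simp add: real_lebesgue_integral_def enn2real_plus)
  moreover have "integral\<^sup>L ?M (?a \<psi>) = (LINT x:{0..}|?M. \<psi> x)"
    by (simp add: set_lebesgue_integral_def)
  moreover have "integral\<^sup>L ?I (?b \<psi>)
    = (LINT x:age_range G|?I. \<psi> (x + t) * ((1 - G (x + t)) / (1 - G x)))"
    unfolding set_lebesgue_integral_def
    using age_range_iff[OF dist] t by (intro Bochner_Integration.integral_cong) (auto simp: indicator_def)
  moreover have "integral\<^sup>L ?N (?c \<psi>) = (LINT s:{0..t}|density lborel entry. \<psi> (t - s) * (1 - G (t - s)))"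
  proof -
    have N: "?N = density (density lborel entry) (\<lambda>s. ennreal (indicator {..t} s))"
      by (subst density_density_eq) (auto simp: ennreal_indicator)
    have "?c \<psi> \<in> borel_measurable (density lborel entry)"
      using bm by measurable
    then have "integral\<^sup>L ?N (?c \<psi>) = (LINT s|density lborel entry. indicator {..t} s *\<^sub>R ?c \<psi> s)"
      unfolding N by (intro integral_density) auto
    moreover have "indicator {..t} s *\<^sub>R ?c \<psi> s = indicator {0..t} s *\<^sub>R (\<psi> (t - s) * (1 - G (t - s)))" for s
      by (cases "s \<in> {0..t}") auto
    ultimately show ?thesis
      unfolding set_lebesgue_integral_def by (simp only:)
  qed
  ultimately show ?thesis by simp
qed

section \<open>Total masses and cumulative entries\<close>

lemma emeasure_content:
  assumes t: "0 \<le> t" and A: "A \<in> sets borel" "age_range G \<subseteq> A"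
  shows "emeasure (density lborel (dens t)) A = ennreal (fluid_content f t \<infinity>)"
proof -
  have "emeasure (density lborel (dens t)) A = (\<integral>\<^sup>+x. dens t x * indicator A x \<partial>lborel)"
    using A by (simp add: emeasure_density)
  also have "\<dots> = (\<integral>\<^sup>+x. dens t x \<partial>lborel)"
  proof (rule nn_integral_cong_AE)
    show "AE x in lborel. dens t x * indicator A x = dens t x"
      using AE_dens[OF t]
    proof eventually_elim
      case (elim x)
      moreover have "f t x = 0" if "0 \<le> x" "x \<notin> A"
        using ages that t A by (auto simp: ages_along_def)
      ultimately show ?case by (auto simp: indicator_def)
    qed
  qed
  finally show ?thesis by (simp add: total_content t)
qed

lemma measure_content:
  assumes "0 \<le> t" "A \<in> sets borel" "age_range G \<subseteq> A"
  shows "measure (density lborel (dens t)) A = fluid_content f t \<infinity>"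
  using assms by (simp add: measure_def emeasure_content content_nonneg)

lemma finite_measure_on_dens:
  assumes "0 \<le> t"
  shows "finite_measure_on G (density lborel (dens t))"
proof -
  interpret finite_measure "density lborel (dens t)" by (rule finite_measure_dens) fact
  have "emeasure (density lborel (dens t)) (UNIV - age_range G)
    = emeasure (density lborel (dens t)) UNIV - emeasure (density lborel (dens t)) (age_range G)"
    by (intro emeasure_Diff) auto
  also have "\<dots> = 0"
    using assms by (simp add: emeasure_content)
  finally show ?thesis
    by (simp add: finite_measure_on_def finite_measure_axioms Compl_eq_Diff_UNIV)
qed

lemma departure_rate_eq:
  assumes "0 \<le> t" "\<nu> t = density lborel (dens t)"
  shows "departure_rate G g \<nu> t = loss_rate G g f t"
proof -
  have "departure_rate G g \<nu> t
    = (\<integral>\<^sup>+x. indicator (age_range G) x * ennreal (hazard G g x) \<partial>density lborel (dens t))"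
    by (simp add: departure_rate_def assms mult.commute)
  then show ?thesis
    by (simp add: nn_integral_density loss_rate_eq assms)
qed

lemma emeasure_entry: "emeasure (density lborel entry) {..t} = (\<integral>\<^sup>+s. entry s * indicator {..t} s \<partial>lborel)"
  by (simp add: emeasure_density)

text \<open>In \<open>conservation\<close> the side of initial content and entries is finite, which
  forces the cumulative loss to be finite even though the rate may be infinite at single times. Only
  then can the equation be moved to the reals and the initial content subtracted.\<close>

lemma fluid_balance:
  assumes "0 \<le> t"
  shows loss_finite: "(\<integral>\<^sup>+s\<in>{0..t}. loss_rate G g f s \<partial>lebesgue) < \<infinity>"
    and entries_eq: "fluid_content f t \<infinity> + enn2real (\<integral>\<^sup>+s\<in>{0..t}. loss_rate G g f s \<partial>lebesgue)
      - fluid_content f 0 \<infinity> = measure (density lborel entry) {..t}"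
proof -
  have "(\<integral>\<^sup>+x. init x \<partial>lborel) = ennreal (fluid_content f 0 \<infinity>)"
    unfolding total_content[OF order_refl] using dens_zero by (intro nn_integral_cong_AE) auto
  then have eq: "ennreal (fluid_content f t \<infinity>) + (\<integral>\<^sup>+s\<in>{0..t}. loss_rate G g f s \<partial>lebesgue)
    = ennreal (fluid_content f 0 \<infinity>) + emeasure (density lborel entry) {..t}"
    using conservation[OF assms] by (simp add: total_content assms emeasure_entry)
  have fin: "emeasure (density lborel entry) {..t} < \<infinity>"
    unfolding emeasure_entry by (rule entry_cumulative_finite)
  then have "ennreal (fluid_content f t \<infinity>) + (\<integral>\<^sup>+s\<in>{0..t}. loss_rate G g f s \<partial>lebesgue) < \<infinity>"
    unfolding eq by (simp add: ennreal_add_less_top)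
  then show L: "(\<integral>\<^sup>+s\<in>{0..t}. loss_rate G g f s \<partial>lebesgue) < \<infinity>"
    by (simp add: ennreal_add_less_top)
  show "fluid_content f t \<infinity> + enn2real (\<integral>\<^sup>+s\<in>{0..t}. loss_rate G g f s \<partial>lebesgue)
      - fluid_content f 0 \<infinity> = measure (density lborel entry) {..t}"
    using arg_cong[OF eq, of enn2real] L fin assms
    by (simp add: enn2real_plus content_nonneg measure_def)
qed

lemma entry_null: "emeasure (density lborel entry) {..0} = 0"
proof -
  have "(\<integral>\<^sup>+s. entry s * indicator {..0} s \<partial>lborel) = (\<integral>\<^sup>+s. 0 \<partial>(lborel :: real measure))"
  proof (rule nn_integral_cong_AE)
    show "AE s in lborel. entry s * indicator {..0} s = 0"
      using AE_lborel_singleton[of "0::real"]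
      by eventually_elim (auto simp: indicator_def entry_eq_0)
  qed
  then show ?thesis by (simp add: emeasure_entry)
qed

lemma entry_locally_finite: "emeasure (density lborel entry) {..t} < \<infinity>"
  unfolding emeasure_entry by (rule entry_cumulative_finite)

text \<open>This undoes the passage to a Borel version; for the potential queue it produces the
  integral against \<open>lam\<close>. Measurability is asked only after cutting to
  \<open>{0..t}\<close>, since \<open>h\<close> will contain \<open>\<psi> (t - s)\<close>, which is
  controlled for \<open>s \<le> t\<close> only.\<close>

lemma integral_entry:
  assumes h: "(\<lambda>s. indicator {0..t} s * h s) \<in> borel_measurable borel"
  shows "(LINT s:{0..t}|density lborel entry. h s) = (LINT s:{0..t}|lebesgue. h s * f s 0)"
proof -
  let ?h = "\<lambda>s. indicator {0..t} s * h s" and ?e = "\<lambda>s. enn2real (entry s)"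
  note [measurable] = h
  \<comment> \<open>A Bochner integral against a density needs real values; \<open>entry\<close> is
    almost everywhere of the form \<open>ennreal (f s 0)\<close> or 0, hence finite.\<close>
  have "density lborel entry = density lborel (\<lambda>s. ennreal (?e s))"
  proof (rule density_cong)
    show "AE s in lborel. entry s = ennreal (?e s)"
      using AE_entry
    proof eventually_elim
      case (elim s)
      then show ?case by (cases "0 \<le> s") (auto simp: entry_eq_0 f_nonneg)
    qed
  qed auto
  then have "(LINT s:{0..t}|density lborel entry. h s)
    = (LINT s|density lborel (\<lambda>s. ennreal (?e s)). ?h s)"
    by (simp add: set_lebesgue_integral_def)
  also have "\<dots> = (LINT s|lborel. ?e s *\<^sub>R ?h s)"
    by (intro integral_density) auto
  also have "\<dots> = (LINT s|lebesgue. ?e s *\<^sub>R ?h s)"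
    by (intro integral_completion[symmetric]) auto
  also have "\<dots> = (LINT s|lebesgue. ?h s * (indicator {0..} s * f s 0))"
  proof (rule integral_cong_AE)
    show "(\<lambda>s. ?e s *\<^sub>R ?h s) \<in> borel_measurable lebesgue"
      by (intro measurable_completion) auto
    have "?h \<in> borel_measurable lebesgue"
      by (intro measurable_completion) auto
    then show "(\<lambda>s. ?h s * (indicator {0..} s * f s 0)) \<in> borel_measurable lebesgue"
      using lebesgue_entry by (rule borel_measurable_times)
    show "AE s in lebesgue. ?e s *\<^sub>R ?h s = ?h s * (indicator {0..} s * f s 0)"
      using AE_completion[OF AE_entry]
      by eventually_elim (auto simp: indicator_def f_nonneg)
  qed
  also have "\<dots> = (LINT s:{0..t}|lebesgue. h s * f s 0)"
    unfolding set_lebesgue_integral_def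
    by (intro Bochner_Integration.integral_cong) (auto simp: indicator_def)
  finally show ?thesis .
qed

section \<open>Queue front and queue boundary\<close>

text \<open>
  The queue front is never beyond the boundary \<open>w\<close> inside the age range, and both cut off the same
  mass, so there is no fluid between them.
\<close>

lemma reneging_rate_eq:
  assumes t: "0 \<le> t" and w: "queue_boundary f q w" and q: "density_family q"
    and X: "queue_length X t = fluid_content q t \<infinity>"
    and \<eta>: "\<eta> t = density lborel (dens t)"
  shows "reneging_rate G g \<eta> X t = loss_rate G g q t"
proof -
  let ?M = "density lborel (dens t)" and ?c = "fluid_content q t \<infinity>"
    and ?\<chi> = "queue_front G \<eta> X t"
  let ?h = "\<lambda>x. indicator (age_range G) x * ennreal (hazard G g x)"
  interpret finite_measure ?M by (rule finite_measure_dens) fact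
  have w0: "0 \<le> w t" and wc: "fluid_content f t (w t) = ?c"
    and wq: "\<And>x. 0 < x \<Longrightarrow> ereal x \<le> w t \<Longrightarrow> q t x = f t x"
       "\<And>x. 0 < x \<Longrightarrow> w t < ereal x \<Longrightarrow> q t x = 0"
    using w t by (auto simp: queue_boundary_def)
  have z: "dens t x = 0" if "x < 0" for x
    using that t by (simp add: dens_def init_eq_0)
  have content: "emeasure ?M A = ennreal (fluid_content f t y)"
    if "A \<in> sets borel" "A \<inter> {0..} = {x. ereal x \<le> y} \<inter> {0..}" for A y
  proof -
    have "x \<in> A \<longleftrightarrow> ereal x \<le> y" if "0 \<le> x" for x
      using \<open>A \<inter> {0..} = {x. ereal x \<le> y} \<inter> {0..}\<close> that by (auto simp: set_eq_iff)
    then have "dens t x * indicator A x = dens t x * indicator {x. ereal x \<le> y} x" for x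
      using z[of x] by (cases "0 \<le> x") (auto simp: indicator_def)
    then show ?thesis
      using that by (simp add: emeasure_density fluid_content_eq t)
  qed
  have loss: "loss_rate G g q t = (\<integral>\<^sup>+x. dens t x * (?h x * indicator {x. ereal x \<le> w t} x) \<partial>lborel)"
  proof -
    have "loss_rate G g q t = (\<integral>\<^sup>+x. dens t x * (?h x * indicator {x. ereal x \<le> w t} x) \<partial>lebesgue)"
      unfolding loss_rate_def
    proof (rule nn_integral_cong_AE)
      show "AE x in lebesgue. ennreal (q t x * hazard G g x) * indicator (age_range G) x
          = dens t x * (?h x * indicator {x. ereal x \<le> w t} x)"
        using AE_completion[OF AE_dens[OF t]] AE_completion[OF AE_lborel_singleton[of "0::real"]]
      proof eventually_elim
        case (elim x)
        show ?case
        proof (cases "x \<in> age_range G")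
          case True
          \<comment> \<open>Age 0, where \<open>q\<close> and \<open>f\<close> may differ, has been
            removed as a null set.\<close>
          then have "0 < x" using elim age_range_iff[OF dist, of x] by auto
          then show ?thesis
            using True elim wq[of x] hazard_nonneg[of x] f_nonneg[OF t, of x]
            by (cases "ereal x \<le> w t") (auto simp: ennreal_mult)
        qed simp
      qed
    qed
    then show ?thesis by (simp add: nn_integral_completion)
  qed
  have "reneging_rate G g \<eta> X t = (\<integral>\<^sup>+x. ?h x * indicator {x. ereal x \<le> ?\<chi>} x \<partial>?M)"
    unfolding reneging_rate_def \<eta> by (intro nn_integral_cong) (auto simp: indicator_def)
  also have "\<dots> = (\<integral>\<^sup>+x. dens t x * (?h x * indicator {x. ereal x \<le> ?\<chi>} x) \<partial>lborel)"
    by (rule nn_integral_density) measurable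
  also have "\<dots> = loss_rate G g q t"
    unfolding loss
  proof (rule nn_integral_cong_AE)
    let ?S = "{x \<in> age_range G. queue_length X t \<le> measure (\<eta> t) {0..x}}"
    have \<chi>: "?\<chi> = Inf (ereal ` ?S)" by (simp add: queue_front_def)
    have c0: "0 \<le> ?c"
      using content_nonneg[OF t, of "w t"] wc by simp
    \<comment> \<open>If some age lies beyond \<open>w t\<close>, then \<open>w t\<close> is itself
      an age, and the mass up to it is exactly the queue content, so it competes in the infimum
      defining the front.\<close>
    have below: "w t \<in> ereal ` ?S" if x: "w t < ereal x" "x \<in> age_range G" for x
    proof -
      obtain y where y: "w t = ereal y" using w0 x(1) by (cases "w t") auto
      have "y \<in> age_range G"
        using x w0 y age_range_iff[OF dist] monoD[OF mono_dist[OF dist], of y x] by auto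
      moreover have "emeasure ?M {0..y} = ennreal ?c"
        unfolding wc[symmetric] by (rule content) (auto simp: y)
      ultimately show ?thesis
        using c0 by (auto simp: y X \<eta> measure_def)
    qed
    show "AE x in lborel. dens t x * (?h x * indicator {x. ereal x \<le> ?\<chi>} x)
        = dens t x * (?h x * indicator {x. ereal x \<le> w t} x)"
    proof (cases "?S = {}")
      case True
      \<comment> \<open>The infimum of the empty set is \<open>\<infinity>\<close>, and by
        \<open>below\<close> no age lies beyond \<open>w t\<close>: both cut-offs keep the whole age
        range.\<close>
      then have "?\<chi> = \<infinity>" by (simp only: \<chi> image_empty) (simp add: top_ereal_def)
      moreover have "ereal x \<le> w t" if "x \<in> age_range G" for x
        using below[OF _ that] True by (cases "ereal x \<le> w t") (auto simp: not_le)
      ultimately show ?thesis by (intro AE_I2) (auto simp: indicator_def)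
    next
      case False
      then obtain x0 where x0: "x0 \<in> ?S" by blast
      have "?\<chi> \<le> ereal x0" unfolding \<chi> using x0 by (intro Inf_lower) auto
      moreover have "0 \<le> ?\<chi>"
        unfolding \<chi> by (intro Inf_greatest) (auto simp: age_range_def)
      ultimately obtain r where r: "?\<chi> = ereal r" "0 \<le> r" by (cases ?\<chi>) auto
      have le: "?\<chi> \<le> w t"
      proof (cases "w t < ereal x0")
        case True
        then show ?thesis unfolding \<chi> using below x0 by (intro Inf_lower) auto
      qed (use \<open>?\<chi> \<le> ereal x0\<close> in \<open>auto simp: not_less intro: order_trans\<close>)
      \<comment> \<open>Every point right of \<open>r\<close> lies above a member of
        \<open>?S\<close>, so the mass up to it is at least \<open>?c\<close>; right-continuity
        carries the bound to \<open>r\<close>.\<close>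
      have front: "?c \<le> measure ?M {..r}"
      proof (rule tendsto_lowerbound)
        show "((\<lambda>x. measure ?M {..x}) \<longlongrightarrow> measure ?M {..r}) (at_right r)"
        proof -
          have "emeasure ?M {..y} < \<infinity>" for y
            by (simp add: less_top[symmetric])
          then have "continuous (at_right r) (\<lambda>x. measure ?M {..x})"
            by (intro measure_atMost_right_continuous) auto
          then show ?thesis by (simp add: continuous_within)
        qed
        show "\<forall>\<^sub>F x in at_right r. ?c \<le> measure ?M {..x}"
          using eventually_at_right_less[of r]
        proof eventually_elim
          case (elim x)
          then have "Inf (ereal ` ?S) < ereal x" using r \<chi> by simp
          then obtain y where y: "y \<in> ?S" "y < x" by (auto simp: Inf_less_iff)
          then have "?c \<le> measure ?M {0..y}" by (simp add: X \<eta>)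
          also have "\<dots> \<le> measure ?M {..x}" using y by (intro finite_measure_mono) auto
          finally show ?case .
        qed
      qed simp
      let ?D = "{x. ereal x \<le> w t} - {..r}"
      have mD[measurable]: "{x. ereal x \<le> w t} \<in> sets borel" by measurable
      have "emeasure ?M ?D = emeasure ?M {x. ereal x \<le> w t} - emeasure ?M {..r}"
        using le r by (intro emeasure_Diff) (auto intro: order_trans[of _ "ereal r"])
      also have "emeasure ?M {x. ereal x \<le> w t} = ennreal ?c"
        unfolding wc[symmetric] by (rule content) auto
      \<comment> \<open>The front already holds mass at least \<open>?c\<close>, so the truncated
        difference leaves nothing between front and boundary.\<close>
      also have "ennreal ?c - emeasure ?M {..r} = 0"
        using front by (intro diff_eq_0_ennreal) (auto simp: emeasure_eq_measure ennreal_leI)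
      finally have "(\<integral>\<^sup>+x. dens t x * indicator ?D x \<partial>lborel) = 0"
        by (simp add: emeasure_density)
      then have "AE x in lborel. dens t x * indicator ?D x = 0"
        by (subst (asm) nn_integral_0_iff_AE) auto
      then show ?thesis
      proof eventually_elim
        case (elim x)
        have "ereal x \<le> w t" if "x \<le> r"
          using that le r by (auto intro: order_trans[of _ "ereal r"])
        with elim r show ?case by (auto simp: indicator_def split: if_splits)
      qed
    qed
  qed
  finally show ?thesis .
qed

end

section \<open>From the two-parameter to the measure-valued model\<close>

text \<open>Integrability is given only on bounded intervals; the half-line is reached as a
  pointwise limit of truncations.\<close>

lemma arrival_rate_measurable:
  assumes "arrival_rate lam"
  shows "lam \<in> borel_measurable (lebesgue_on {0..})"
proof -
  have "(\<lambda>s. indicator {0..} s * lam s) \<in> borel_measurable lebesgue"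
  proof (rule borel_measurable_LIMSEQ_real)
    show "(\<lambda>s. indicator {0..real n} s * lam s) \<in> borel_measurable lebesgue" for n
      using assms by (auto simp: arrival_rate_def set_integrable_def dest!: spec[of _ "real n"]
          dest: borel_measurable_integrable)
    show "(\<lambda>n. indicator {0..real n} s * lam s) \<longlonglongrightarrow> indicator {0..} s * lam s" for s
    proof (rule tendsto_eventually)
      obtain N :: nat where "s \<le> real N" using real_arch_simple by blast
      then have "indicator {0..real n} s * lam s = indicator {0..} s * lam s" if "N \<le> n" for n
        using that by (auto simp: indicator_def)
      then show "\<forall>\<^sub>F n in sequentially. indicator {0..real n} s * lam s = indicator {0..} s * lam s"
        by (auto simp: eventually_sequentially)
    qed
  qed
  then show ?thesis
    by (subst borel_measurable_restrict_space_iff) (auto simp: mult.commute)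
qed

lemma arrivals_eq:
  assumes "arrival_rate lam" "0 \<le> t"
  shows "(\<integral>\<^sup>+s\<in>{0..t}. ennreal (lam s) \<partial>lebesgue) = ennreal (arrivals lam t)" "0 \<le> arrivals lam t"
proof -
  have int: "integrable lebesgue (\<lambda>s. indicator {0..t} s *\<^sub>R lam s)"
    and nn: "\<And>s. 0 \<le> indicator {0..t} s *\<^sub>R lam s"
    using assms by (auto simp: arrival_rate_def set_integrable_def indicator_def)
  have "(\<integral>\<^sup>+s\<in>{0..t}. ennreal (lam s) \<partial>lebesgue)
    = (\<integral>\<^sup>+s. ennreal (indicator {0..t} s *\<^sub>R lam s) \<partial>lebesgue)"
    by (intro nn_integral_cong) (auto simp: indicator_def)
  also have "\<dots> = ennreal (arrivals lam t)"
    unfolding arrivals_def set_lebesgue_integral_def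
    using int nn by (intro nn_integral_eq_integral) auto
  finally show "(\<integral>\<^sup>+s\<in>{0..t}. ennreal (lam s) \<partial>lebesgue) = ennreal (arrivals lam t)" .
  show "0 \<le> arrivals lam t"
    unfolding arrivals_def set_lebesgue_integral_def using nn by (intro integral_nonneg_AE) auto
qed

lemma fluid_content_cong:
  assumes "density_family f" "density_family h" "0 \<le> t" and eq: "\<And>x. 0 < x \<Longrightarrow> f t x = h t x"
  shows "fluid_content f t \<infinity> = fluid_content h t \<infinity>"
proof -
  have "set_integrable lebesgue {0..} (f t)" "set_integrable lebesgue {0..} (h t)"
    using assms by (auto simp: density_family_def)
  moreover have "{x. 0 \<le> x \<and> ereal x \<le> \<infinity>} = {0..}" by auto
  ultimately show ?thesis
    unfolding fluid_content_def set_lebesgue_integral_def set_integrable_def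
  proof (simp only:, intro integral_cong_AE)
    show "AE x in lebesgue. indicator {0..} x *\<^sub>R f t x = indicator {0..} x *\<^sub>R h t x"
      using AE_completion[OF AE_lborel_singleton[of "0::real"]]
      by eventually_elim (auto simp: indicator_def eq)
  qed (auto dest: borel_measurable_integrable)
qed

theorem proposition4p2:
  fixes lam Gs gs Gr gr :: "real \<Rightarrow> real"
    and b qt q :: "real \<Rightarrow> real \<Rightarrow> real"
    and \<eta> \<nu> :: "real \<Rightarrow> real measure"
    and X :: "real \<Rightarrow> real"
  assumes "arrival_rate lam"
    and "dist_with_density Gs gs"
    and "dist_with_density Gr gr"
    and "whitt_model Gs gs Gr gr lam b qt q"
    and "\<And>t. t \<ge> 0 \<Longrightarrow> halfline_measure_of (\<eta> t) (\<lambda>y. fluid_content qt t (ereal y))"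
    and "\<And>t. t \<ge> 0 \<Longrightarrow> halfline_measure_of (\<nu> t) (\<lambda>y. fluid_content b t (ereal y))"
    and "\<And>t. t \<ge> 0 \<Longrightarrow> X t = fluid_content b t \<infinity> + fluid_content q t \<infinity>"
  shows "kang_ramanan_model Gs gs Gr gr lam \<eta> \<nu> X \<and> (\<eta> 0, \<nu> 0, X 0) \<in> S0 Gs Gr"
proof -
  note lam = \<open>arrival_rate lam\<close> and W = \<open>whitt_model Gs gs Gr gr lam b qt q\<close>[unfolded whitt_model_def]
  have fam: "density_family b" "density_family qt" "density_family q"
    and B1: "\<And>t y. 0 \<le> t \<Longrightarrow> 0 \<le> y \<Longrightarrow> fluid_content b t y \<le> 1"
    and q0: "\<And>x. 0 < x \<Longrightarrow> q 0 x = qt 0 x"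
    and ages: "ages_along Gs b" "ages_along Gr qt"
    and busy: "\<And>t. 0 \<le> t \<Longrightarrow> 0 < fluid_content q t \<infinity> \<Longrightarrow> fluid_content b t \<infinity> = 1"
    and qt0: "\<And>t. 0 \<le> t \<Longrightarrow> qt t 0 = lam t"
    and b_meas: "(\<lambda>s. b s 0) \<in> borel_measurable (lebesgue_on {0..})"
    and alpha_meas: "loss_rate Gr gr q \<in> borel_measurable (lebesgue_on {0..})"
    and balance: "\<And>t. 0 \<le> t \<Longrightarrow> ennreal (arrivals lam t) + ennreal (fluid_content q 0 \<infinity>) =
        ennreal (fluid_content q t \<infinity>) + (\<integral>\<^sup>+s\<in>{0..t}. ennreal (b s 0) \<partial>lebesgue)
          + (\<integral>\<^sup>+s\<in>{0..t}. loss_rate Gr gr q s \<partial>lebesgue)"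
    using W by blast+
  obtain w where w: "queue_boundary qt q w" using W by blast
  note cont_nonneg = fluid_content_nonneg[OF fam(1)] fluid_content_nonneg[OF fam(3)]
  \<comment> \<open>Both integrals are summands of the finite total in \<open>balance\<close>. The
    first bound supplies \<open>entry_finite\<close> for the service fluid.\<close>
  have fin: "(\<integral>\<^sup>+s\<in>{0..t}. ennreal (b s 0) \<partial>lebesgue) < \<infinity>"
    "(\<integral>\<^sup>+s\<in>{0..t}. loss_rate Gr gr q s \<partial>lebesgue) < \<infinity>" if "0 \<le> t" for t
  proof -
    have "ennreal (arrivals lam t) + ennreal (fluid_content q 0 \<infinity>) < \<infinity>"
      by (simp add: ennreal_add_less_top)
    then show "(\<integral>\<^sup>+s\<in>{0..t}. ennreal (b s 0) \<partial>lebesgue) < \<infinity>"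
      "(\<integral>\<^sup>+s\<in>{0..t}. loss_rate Gr gr q s \<partial>lebesgue) < \<infinity>"
      unfolding balance[OF that] by (simp_all add: ennreal_add_less_top)
  qed
  interpret S: ageing_fluid Gs gs b
    by unfold_locales (use assms(2) fam ages b_meas fin in auto)
  interpret R: ageing_fluid Gr gr qt
  proof
    show "(\<lambda>s. qt s 0) \<in> borel_measurable (lebesgue_on {0..})"
      using arrival_rate_measurable[OF lam] by (subst measurable_cong[where g=lam]) (auto simp: qt0)
    show "(\<integral>\<^sup>+s\<in>{0..t}. ennreal (qt s 0) \<partial>lebesgue) < \<infinity>" if "0 \<le> t" for t
    proof -
      have "(\<integral>\<^sup>+s\<in>{0..t}. ennreal (qt s 0) \<partial>lebesgue) = (\<integral>\<^sup>+s\<in>{0..t}. ennreal (lam s) \<partial>lebesgue)"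
        by (intro nn_integral_cong) (auto simp: indicator_def qt0)
      then show ?thesis by (simp add: arrivals_eq[OF lam that])
    qed
  qed (use assms(3) fam ages in auto)
  have \<eta>: "\<eta> t = density lborel (R.dens t)" and \<nu>: "\<nu> t = density lborel (S.dens t)" if "0 \<le> t" for t
    using R.halfline_measure_eq[OF that assms(5)[OF that]] S.halfline_measure_eq[OF that assms(6)[OF that]]
    by auto
  have X: "X t = fluid_content b t \<infinity> + fluid_content q t \<infinity>" if "0 \<le> t" for t
    using assms(7)[OF that] .
  \<comment> \<open>An empty queue leaves \<open>X t \<le> 1\<close>; a nonempty one forces the
    service content to be 1. Either way the positive part of \<open>X t - 1\<close> is the queue
    content.\<close>
  have Q: "queue_length X t = fluid_content q t \<infinity>" if "0 \<le> t" for t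
    using busy[OF that] B1[OF that, of \<infinity>] cont_nonneg(2)[OF that, of \<infinity>]
    by (cases "fluid_content q t \<infinity> = 0") (auto simp: queue_length_def X that)
  have Bmin: "fluid_content b t \<infinity> = min (X t) 1" if "0 \<le> t" for t
    using busy[OF that] B1[OF that, of \<infinity>] cont_nonneg(2)[OF that, of \<infinity>]
    by (cases "fluid_content q t \<infinity> = 0") (auto simp: X that)
  have age: "age_range G \<subseteq> {0..}" for G by (auto simp: age_range_def)
  have mass: "measure (\<nu> t) (age_range Gs) = fluid_content b t \<infinity>"
    "measure (\<nu> t) {0..} = fluid_content b t \<infinity>" if "0 \<le> t" for t
    using that age by (auto simp: \<nu> S.measure_content)
  have fm: "finite_measure_on Gr (\<eta> t)" "finite_measure_on Gs (\<nu> t)" if "0 \<le> t" for t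
    using that by (simp_all add: \<eta> \<nu> R.finite_measure_on_dens S.finite_measure_on_dens)
  have S0: "(\<eta> 0, \<nu> 0, X 0) \<in> S0 Gs Gr"
  proof -
    \<comment> \<open>\<open>\<eta> 0\<close> has the mass of \<open>qt\<close>, whereas
      \<open>X 0\<close> counts \<open>q\<close>. The two densities agree at time 0 except possibly
      at age 0.\<close>
    have "measure (\<eta> 0) (age_range Gr) = fluid_content q 0 \<infinity>"
      using fluid_content_cong[OF fam(3,2) order_refl q0] by (simp add: \<eta> R.measure_content)
    moreover have "1 - fluid_content b 0 \<infinity> = max (1 - X 0) 0"
      using Bmin[OF order_refl] by (auto simp: min_def)
    moreover have "fluid_content b 0 \<infinity> + fluid_content q 0 \<infinity> = X 0" "0 \<le> X 0"
      using X[of 0] cont_nonneg[of 0 \<infinity>] by auto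
    ultimately show ?thesis
      using fm[OF order_refl] mass(1)[OF order_refl] by (simp add: S0_def)
  qed
  have dep: "departure_rate Gs gs \<nu> t = loss_rate Gs gs b t" if "0 \<le> t" for t
    using that by (intro S.departure_rate_eq) (auto simp: \<nu>)
  have ren: "reneging_rate Gr gr \<eta> X t = loss_rate Gr gr q t" if "0 \<le> t" for t
    using that by (intro R.reneging_rate_eq[OF _ w fam(3)]) (auto simp: \<eta> Q)
  have deps: "departures Gs gs \<nu> t = (\<integral>\<^sup>+s\<in>{0..t}. loss_rate Gs gs b s \<partial>lebesgue)" for t
    unfolding departures_def by (intro nn_integral_cong) (auto simp: dep indicator_def)
  have rens: "reneged Gr gr \<eta> X t = (\<integral>\<^sup>+s\<in>{0..t}. loss_rate Gr gr q s \<partial>lebesgue)" for t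
    unfolding reneged_def by (intro nn_integral_cong) (auto simp: ren indicator_def)
  let ?N = "density lborel S.entry"
  have K: "service_entries Gs gs \<nu> t = measure ?N {..t}" if "0 \<le> t" for t
    using S.entries_eq[OF that] that by (simp add: service_entries_def mass deps)
  have stieltjes: "stieltjes (service_entries Gs gs \<nu>) = ?N"
    by (rule stieltjes_eq) (auto simp: S.entry_null S.entry_locally_finite[simplified] K)
  \<comment> \<open>The \<open>ennreal\<close> form is what can be substituted into
    \<open>balance\<close>, where Whitt's cumulative entries occur.\<close>
  have K_cum: "ennreal (service_entries Gs gs \<nu> t) = (\<integral>\<^sup>+s\<in>{0..t}. ennreal (b s 0) \<partial>lebesgue)"
    if "0 \<le> t" for t
    using S.entry_locally_finite[of t]
    by (simp add: K[OF that] less_top S.emeasure_entry S.entry_cumulative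
        flip: emeasure_eq_ennreal_measure)
  have K_mono: "mono_on {0..} (service_entries Gs gs \<nu>)"
  proof (rule mono_onI)
    fix s t :: real assume "s \<in> {0..}" "t \<in> {0..}" "s \<le> t"
    then show "service_entries Gs gs \<nu> s \<le> service_entries Gs gs \<nu> t"
      using S.entry_locally_finite[of t]
      by (simp add: K measure_def) (intro enn2real_mono emeasure_mono, auto)
  qed
  have K_cont: "continuous (at_right t) (service_entries Gs gs \<nu>)" if "0 \<le> t" for t
  proof -
    have "((\<lambda>s. measure ?N {..s}) \<longlongrightarrow> measure ?N {..t}) (at_right t)"
      using measure_atMost_right_continuous[of ?N t] S.entry_locally_finite by (simp add: continuous_within)
    moreover have "\<forall>\<^sub>F s in at_right t. measure ?N {..s} = service_entries Gs gs \<nu> s"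
      using eventually_at_right_less[of t] by eventually_elim (use that in \<open>simp add: K\<close>)
    ultimately have "(service_entries Gs gs \<nu> \<longlongrightarrow> measure ?N {..t}) (at_right t)"
      by (rule Lim_transform_eventually)
    then show ?thesis by (simp add: continuous_within K that)
  qed
  have weak: "(LINT x:{0..}|\<eta> t. \<psi> x) =
           (LINT x:age_range Gr|\<eta> 0. \<psi> (x + t) * ((1 - Gr (x + t)) / (1 - Gr x)))
           + (LINT s:{0..t}|lebesgue. \<psi> (t - s) * (1 - Gr (t - s)) * lam s)"
         "(LINT x:{0..}|\<nu> t. \<psi> x) =
           (LINT x:age_range Gs|\<nu> 0. \<psi> (x + t) * ((1 - Gs (x + t)) / (1 - Gs x)))
           + (LINT s:{0..t}|stieltjes (service_entries Gs gs \<nu>). \<psi> (t - s) * (1 - Gs (t - s)))"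
    if \<psi>: "continuous_on {0..} \<psi>" "bounded (\<psi> ` {0..})" and t: "0 \<le> t" for \<psi> t
  proof -
    have [measurable]: "(\<lambda>x. indicator {0..} x * \<psi> x) \<in> borel_measurable borel"
      using borel_measurable_continuous_on_indicator[OF _ \<psi>(1)] by simp
    have "(\<lambda>s. indicator {0..t} s * ((indicator {0..} (t - s) * \<psi> (t - s)) * (1 - Gr (t - s))))
        \<in> borel_measurable borel"
      by measurable
    also have "(\<lambda>s. indicator {0..t} s * ((indicator {0..} (t - s) * \<psi> (t - s)) * (1 - Gr (t - s))))
        = (\<lambda>s. indicator {0..t} s * (\<psi> (t - s) * (1 - Gr (t - s))))"
      by (auto simp: indicator_def)
    finally have "(LINT s:{0..t}|density lborel R.entry. \<psi> (t - s) * (1 - Gr (t - s)))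
        = (LINT s:{0..t}|lebesgue. \<psi> (t - s) * (1 - Gr (t - s)) * qt s 0)"
      by (rule R.integral_entry)
    also have "\<dots> = (LINT s:{0..t}|lebesgue. \<psi> (t - s) * (1 - Gr (t - s)) * lam s)"
      unfolding set_lebesgue_integral_def
      by (intro Bochner_Integration.integral_cong) (auto simp: indicator_def qt0)
    finally show "(LINT x:{0..}|\<eta> t. \<psi> x) =
           (LINT x:age_range Gr|\<eta> 0. \<psi> (x + t) * ((1 - Gr (x + t)) / (1 - Gr x)))
           + (LINT s:{0..t}|lebesgue. \<psi> (t - s) * (1 - Gr (t - s)) * lam s)"
      unfolding \<eta>[OF t] \<eta>[OF order_refl] by (simp only: R.weak_evolution[OF \<psi> t])
    show "(LINT x:{0..}|\<nu> t. \<psi> x) =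
           (LINT x:age_range Gs|\<nu> 0. \<psi> (x + t) * ((1 - Gs (x + t)) / (1 - Gs x)))
           + (LINT s:{0..t}|stieltjes (service_entries Gs gs \<nu>). \<psi> (t - s) * (1 - Gs (t - s)))"
      unfolding \<nu>[OF t] \<nu>[OF order_refl] stieltjes by (rule S.weak_evolution[OF \<psi> t])
  qed
  have total: "arrivals lam t + queue_length X 0 =
        queue_length X t + service_entries Gs gs \<nu> t + enn2real (reneged Gr gr \<eta> X t)"
    if t: "0 \<le> t" for t
  proof -
    have "0 \<le> service_entries Gs gs \<nu> t" by (simp add: K t)
    then have "enn2real (ennreal (fluid_content q t \<infinity>) + ennreal (service_entries Gs gs \<nu> t)
        + reneged Gr gr \<eta> X t)
      = fluid_content q t \<infinity> + service_entries Gs gs \<nu> t + enn2real (reneged Gr gr \<eta> X t)"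
      using fin(2)[OF t] cont_nonneg(2)[OF t]
      by (simp add: rens enn2real_plus flip: ennreal_plus)
    moreover have "enn2real (ennreal (arrivals lam t) + ennreal (fluid_content q 0 \<infinity>))
      = arrivals lam t + fluid_content q 0 \<infinity>"
      using arrivals_eq(2)[OF lam t] cont_nonneg(2)[of 0] by (simp flip: ennreal_plus)
    ultimately show ?thesis
      using arg_cong[OF balance[OF t], of enn2real] t by (simp add: Q K_cum rens)
  qed
  have dep_meas: "departure_rate Gs gs \<nu> \<in> borel_measurable (lebesgue_on {0..})"
    using S.borel_loss_rate by (subst measurable_cong[where g="loss_rate Gs gs b"]) (auto simp: dep)
  have ren_meas: "reneging_rate Gr gr \<eta> X \<in> borel_measurable (lebesgue_on {0..})"
    using alpha_meas by (subst measurable_cong[where g="loss_rate Gr gr q"]) (auto simp: ren)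
  have idle: "queue_length X t * (1 - measure (\<nu> t) {0..}) = 0" if "0 \<le> t" for t
    using busy[OF that] cont_nonneg(2)[OF that, of \<infinity>]
    by (cases "fluid_content q t \<infinity> = 0") (auto simp: Q mass that)
  have finite: "departures Gs gs \<nu> t < \<infinity>" "reneged Gr gr \<eta> X t < \<infinity>" if "0 \<le> t" for t
    using S.loss_finite[OF that] fin(2)[OF that] by (simp_all add: deps rens)
  have busy_eq: "measure (\<nu> t) {0..} = min (X t) 1" "min (X t) 1 = 1 - max (1 - X t) 0"
    if "0 \<le> t" for t
    using Bmin[OF that] by (auto simp: mass that)
  show ?thesis
    unfolding kang_ramanan_model_def
    by (intro conjI allI impI; (elim conjE)?;
        rule S0 fm dep_meas ren_meas finite K_mono K_cont weak total busy_eq idle; assumption)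
qed

end
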